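(* Let $(\mathcal{C},\otimes,\mathbf{1},\tau)$ be a symmetric monoidal category and let $H=(H,\mu,\eta,\Delta,\varepsilon,S)$ be a Hopf algebra internal to $\mathcal{C}$, with multiplication $\mu:H\otimes H\to H$, unit $\eta:\mathbf{1}\to H$, comultiplication $\Delta:H\to H\otimes H$, counit $\varepsilon:H\to\mathbf{1}$ and antipode $S:H\to H$. Let $\mathcal{C}'\subseteq\mathcal{C}$ be the monoidal (not assumed symmetric) subcategory generated by either $\{\mu,\Delta,\eta\}$ or $\{\mu,\Delta,\varepsilon\}$ and closed under arrow retraction in the following weak sense: for all arrows $\pi,s$ of $\mathcal{C}$ such that $\pi s=\mathrm{id}$ and $s\pi\in\mathcal{C}'$, one has $$s\in\mathcal{C}'\iff \pi\in\mathcal{C}'.$$ Then (in either case) the flip $\tau_{H,H}:H\otimes H\to H\otimes H$, the antipode $S$, the counit $\varepsilon$ and the unit $\eta$ all belong to $\mathcal{C}'$.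
   Context: "The monoidal subcategory generated by a set $X$ of arrows and closed under weak retraction" means the smallest class $\mathcal{C}'$ of arrows of $\mathcal{C}$ that contains $X$, contains the identities of the tensor powers $H^{\otimes n}$, $n\ge 0$ (with $H^{\otimes 0}=\mathbf{1}$) and the associativity and unit constraints between them, is closed under composition and under $\otimes$, and satisfies the stated weak retraction condition. The symmetry $\tau$ of $\mathcal{C}$ is not assumed to belong to $\mathcal{C}'$. A Hopf algebra internal to $\mathcal{C}$ is an object $H$ that is an associative unital algebra $(\mu,\eta)$ and a coassociative counital coalgebra $(\Delta,\varepsilon)$, such that $\Delta$ and $\varepsilon$ are morphisms of unital algebras (with $H\otimes H$ given the tensor-product algebra structure via $\tau$), equipped with $S$ satisfying $\mu(S\otimes\mathrm{id})\Delta=\eta\varepsilon=\mu(\mathrm{id}\otimes S)\Delta$. *)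

theory Defs
  imports Main
begin

section \<open>Categories\<close>

text \<open>
  Objects and arrows are taken from carrier sets; \<open>Comp\<close>, \<open>Id\<close> and the other operations are
  only constrained on these carriers. Composition is written in the usual order:
  \<open>g \<cdot> f\<close> is defined when \<open>Dom g = Cod f\<close>.
\<close>

record ('o, 'a) cat_data =
  Obj :: "'o set"
  Arr :: "'a set"
  Dom :: "'a \<Rightarrow> 'o"
  Cod :: "'a \<Rightarrow> 'o"
  Id :: "'o \<Rightarrow> 'a"
  Comp :: "'a \<Rightarrow> 'a \<Rightarrow> 'a"  (infixr "\<cdot>\<index>" 60)

definition Hom :: "('o, 'a, 'm) cat_data_scheme \<Rightarrow> 'o \<Rightarrow> 'o \<Rightarrow> 'a set" where
  "Hom C A B = {f \<in> Arr C. Dom C f = A \<and> Cod C f = B}"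

locale category =
  fixes C :: "('o, 'a, 'm) cat_data_scheme" (structure)
  assumes Dom_in_Obj: "f \<in> Arr C \<Longrightarrow> Dom C f \<in> Obj C"
    and Cod_in_Obj: "f \<in> Arr C \<Longrightarrow> Cod C f \<in> Obj C"
    and Id_in_Hom: "A \<in> Obj C \<Longrightarrow> Id C A \<in> Hom C A A"
    and Comp_in_Hom: "\<lbrakk>f \<in> Hom C A B; g \<in> Hom C B D\<rbrakk> \<Longrightarrow> g \<cdot> f \<in> Hom C A D"
    and Comp_Id_left: "f \<in> Hom C A B \<Longrightarrow> Id C B \<cdot> f = f"
    and Comp_Id_right: "f \<in> Hom C A B \<Longrightarrow> f \<cdot> Id C A = f"
    and Comp_assoc: "\<lbrakk>f \<in> Hom C A B; g \<in> Hom C B D; h \<in> Hom C D E\<rbrakk>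
      \<Longrightarrow> (h \<cdot> g) \<cdot> f = h \<cdot> (g \<cdot> f)"

definition inverse_arrows :: "('o, 'a, 'm) cat_data_scheme \<Rightarrow> 'a \<Rightarrow> 'a \<Rightarrow> bool" where
  "inverse_arrows C f g \<longleftrightarrow>
     f \<in> Arr C \<and> g \<in> Hom C (Cod C f) (Dom C f) \<and>
     g \<cdot>\<^bsub>C\<^esub> f = Id C (Dom C f) \<and> f \<cdot>\<^bsub>C\<^esub> g = Id C (Cod C f)"

definition is_iso :: "('o, 'a, 'm) cat_data_scheme \<Rightarrow> 'a \<Rightarrow> bool" where
  "is_iso C f \<longleftrightarrow> (\<exists>g. inverse_arrows C f g)"

definition Inv :: "('o, 'a, 'm) cat_data_scheme \<Rightarrow> 'a \<Rightarrow> 'a" where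
  "Inv C f = (THE g. inverse_arrows C f g)"


section \<open>Symmetric monoidal categories\<close>

record ('o, 'a) smc_data = "('o, 'a) cat_data" +
  OTensor :: "'o \<Rightarrow> 'o \<Rightarrow> 'o"  (infixr "\<odot>\<index>" 70)
  Tensor :: "'a \<Rightarrow> 'a \<Rightarrow> 'a"  (infixr "\<otimes>\<index>" 70)
  Unit :: "'o"
  Assoc :: "'o \<Rightarrow> 'o \<Rightarrow> 'o \<Rightarrow> 'a"
  LUnit :: "'o \<Rightarrow> 'a"
  RUnit :: "'o \<Rightarrow> 'a"
  Sym :: "'o \<Rightarrow> 'o \<Rightarrow> 'a"

text \<open>
  \<open>\<odot>\<close> is the tensor product of objects, \<open>\<otimes>\<close> that of arrows. The category is not assumed strict.
\<close>

locale monoidal_category = category C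
  for C :: "('o, 'a, 'm) smc_data_scheme" (structure) +
  assumes OTensor_in_Obj: "\<lbrakk>A \<in> Obj C; B \<in> Obj C\<rbrakk> \<Longrightarrow> A \<odot> B \<in> Obj C"
    and Tensor_in_Hom: "\<lbrakk>f \<in> Hom C A A'; g \<in> Hom C B B'\<rbrakk> \<Longrightarrow> f \<otimes> g \<in> Hom C (A \<odot> B) (A' \<odot> B')"
    and Tensor_Id: "\<lbrakk>A \<in> Obj C; B \<in> Obj C\<rbrakk> \<Longrightarrow> Id C A \<otimes> Id C B = Id C (A \<odot> B)"
    and Tensor_Comp:
      "\<lbrakk>f \<in> Hom C A A'; f' \<in> Hom C A' A''; g \<in> Hom C B B'; g' \<in> Hom C B' B''\<rbrakk>
       \<Longrightarrow> (f' \<cdot> f) \<otimes> (g' \<cdot> g) = (f' \<otimes> g') \<cdot> (f \<otimes> g)"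
    and Unit_in_Obj: "Unit C \<in> Obj C"
    and Assoc_in_Hom: "\<lbrakk>A \<in> Obj C; B \<in> Obj C; D \<in> Obj C\<rbrakk>
      \<Longrightarrow> Assoc C A B D \<in> Hom C ((A \<odot> B) \<odot> D) (A \<odot> (B \<odot> D))"
    and Assoc_iso: "\<lbrakk>A \<in> Obj C; B \<in> Obj C; D \<in> Obj C\<rbrakk> \<Longrightarrow> is_iso C (Assoc C A B D)"
    and Assoc_natural:
      "\<lbrakk>f \<in> Hom C A A'; g \<in> Hom C B B'; h \<in> Hom C D D'\<rbrakk>
       \<Longrightarrow> Assoc C A' B' D' \<cdot> ((f \<otimes> g) \<otimes> h) = (f \<otimes> (g \<otimes> h)) \<cdot> Assoc C A B D"
    and LUnit_in_Hom: "A \<in> Obj C \<Longrightarrow> LUnit C A \<in> Hom C (Unit C \<odot> A) A"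
    and LUnit_iso: "A \<in> Obj C \<Longrightarrow> is_iso C (LUnit C A)"
    and LUnit_natural: "f \<in> Hom C A B \<Longrightarrow> LUnit C B \<cdot> (Id C (Unit C) \<otimes> f) = f \<cdot> LUnit C A"
    and RUnit_in_Hom: "A \<in> Obj C \<Longrightarrow> RUnit C A \<in> Hom C (A \<odot> Unit C) A"
    and RUnit_iso: "A \<in> Obj C \<Longrightarrow> is_iso C (RUnit C A)"
    and RUnit_natural: "f \<in> Hom C A B \<Longrightarrow> RUnit C B \<cdot> (f \<otimes> Id C (Unit C)) = f \<cdot> RUnit C A"
    and pentagon:
      "\<lbrakk>A \<in> Obj C; B \<in> Obj C; D \<in> Obj C; E \<in> Obj C\<rbrakk>
       \<Longrightarrow> Assoc C A B (D \<odot> E) \<cdot> Assoc C (A \<odot> B) D E =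
           (Id C A \<otimes> Assoc C B D E) \<cdot> Assoc C A (B \<odot> D) E \<cdot> (Assoc C A B D \<otimes> Id C E)"
    and triangle:
      "\<lbrakk>A \<in> Obj C; B \<in> Obj C\<rbrakk>
       \<Longrightarrow> (Id C A \<otimes> LUnit C B) \<cdot> Assoc C A (Unit C) B = RUnit C A \<otimes> Id C B"

locale symmetric_monoidal_category = monoidal_category C
  for C :: "('o, 'a, 'm) smc_data_scheme" (structure) +
  assumes Sym_in_Hom: "\<lbrakk>A \<in> Obj C; B \<in> Obj C\<rbrakk> \<Longrightarrow> Sym C A B \<in> Hom C (A \<odot> B) (B \<odot> A)"
    and Sym_natural: "\<lbrakk>f \<in> Hom C A A'; g \<in> Hom C B B'\<rbrakk>
      \<Longrightarrow> Sym C A' B' \<cdot> (f \<otimes> g) = (g \<otimes> f) \<cdot> Sym C A B"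
    and Sym_Sym: "\<lbrakk>A \<in> Obj C; B \<in> Obj C\<rbrakk> \<Longrightarrow> Sym C B A \<cdot> Sym C A B = Id C (A \<odot> B)"
    and hexagon:
      "\<lbrakk>A \<in> Obj C; B \<in> Obj C; D \<in> Obj C\<rbrakk>
       \<Longrightarrow> Assoc C B D A \<cdot> Sym C A (B \<odot> D) \<cdot> Assoc C A B D =
           (Id C B \<otimes> Sym C A D) \<cdot> Assoc C B A D \<cdot> (Sym C A B \<otimes> Id C D)"


section \<open>Hopf algebras internal to a symmetric monoidal category\<close>

definition is_algebra ::
  "('o, 'a, 'm) smc_data_scheme \<Rightarrow> 'o \<Rightarrow> 'a \<Rightarrow> 'a \<Rightarrow> bool" where
  "is_algebra C A m e \<longleftrightarrow>
     A \<in> Obj C \<and> m \<in> Hom C (A \<odot>\<^bsub>C\<^esub> A) A \<and> e \<in> Hom C (Unit C) A \<and>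
     m \<cdot>\<^bsub>C\<^esub> (m \<otimes>\<^bsub>C\<^esub> Id C A) = m \<cdot>\<^bsub>C\<^esub> (Id C A \<otimes>\<^bsub>C\<^esub> m) \<cdot>\<^bsub>C\<^esub> Assoc C A A A \<and>
     m \<cdot>\<^bsub>C\<^esub> (e \<otimes>\<^bsub>C\<^esub> Id C A) = LUnit C A \<and>
     m \<cdot>\<^bsub>C\<^esub> (Id C A \<otimes>\<^bsub>C\<^esub> e) = RUnit C A"

definition is_coalgebra ::
  "('o, 'a, 'm) smc_data_scheme \<Rightarrow> 'o \<Rightarrow> 'a \<Rightarrow> 'a \<Rightarrow> bool" where
  "is_coalgebra C A d c \<longleftrightarrow>
     A \<in> Obj C \<and> d \<in> Hom C A (A \<odot>\<^bsub>C\<^esub> A) \<and> c \<in> Hom C A (Unit C) \<and>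
     Assoc C A A A \<cdot>\<^bsub>C\<^esub> (d \<otimes>\<^bsub>C\<^esub> Id C A) \<cdot>\<^bsub>C\<^esub> d = (Id C A \<otimes>\<^bsub>C\<^esub> d) \<cdot>\<^bsub>C\<^esub> d \<and>
     LUnit C A \<cdot>\<^bsub>C\<^esub> (c \<otimes>\<^bsub>C\<^esub> Id C A) \<cdot>\<^bsub>C\<^esub> d = Id C A \<and>
     RUnit C A \<cdot>\<^bsub>C\<^esub> (Id C A \<otimes>\<^bsub>C\<^esub> c) \<cdot>\<^bsub>C\<^esub> d = Id C A"

definition is_algebra_hom ::
  "('o, 'a, 'm) smc_data_scheme \<Rightarrow> 'o \<Rightarrow> 'a \<Rightarrow> 'a \<Rightarrow> 'o \<Rightarrow> 'a \<Rightarrow> 'a \<Rightarrow> 'a \<Rightarrow> bool" where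
  "is_algebra_hom C A m e B m' e' f \<longleftrightarrow>
     f \<in> Hom C A B \<and>
     f \<cdot>\<^bsub>C\<^esub> m = m' \<cdot>\<^bsub>C\<^esub> (f \<otimes>\<^bsub>C\<^esub> f) \<and>
     f \<cdot>\<^bsub>C\<^esub> e = e'"

text \<open>
  The middle-four interchange \<open>(A \<odot> B) \<odot> (D \<odot> E) \<rightarrow> (A \<odot> D) \<odot> (B \<odot> E)\<close>, that is
  \<open>id \<otimes> \<tau> \<otimes> id\<close> with the associativity constraints made explicit.
\<close>

definition interchange ::
  "('o, 'a, 'm) smc_data_scheme \<Rightarrow> 'o \<Rightarrow> 'o \<Rightarrow> 'o \<Rightarrow> 'o \<Rightarrow> 'a" where
  "interchange C A B D E =
     Inv C (Assoc C A D (B \<odot>\<^bsub>C\<^esub> E)) \<cdot>\<^bsub>C\<^esub>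
     (Id C A \<otimes>\<^bsub>C\<^esub>
       (Assoc C D B E \<cdot>\<^bsub>C\<^esub> (Sym C B D \<otimes>\<^bsub>C\<^esub> Id C E) \<cdot>\<^bsub>C\<^esub> Inv C (Assoc C B D E))) \<cdot>\<^bsub>C\<^esub>
     Assoc C A B (D \<odot>\<^bsub>C\<^esub> E)"

definition tensor_mult ::
  "('o, 'a, 'm) smc_data_scheme \<Rightarrow> 'o \<Rightarrow> 'a \<Rightarrow> 'o \<Rightarrow> 'a \<Rightarrow> 'a" where
  "tensor_mult C A m B m' = (m \<otimes>\<^bsub>C\<^esub> m') \<cdot>\<^bsub>C\<^esub> interchange C A B A B"

definition tensor_unit :: "('o, 'a, 'm) smc_data_scheme \<Rightarrow> 'a \<Rightarrow> 'a \<Rightarrow> 'a" where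
  "tensor_unit C e e' = (e \<otimes>\<^bsub>C\<^esub> e') \<cdot>\<^bsub>C\<^esub> Inv C (LUnit C (Unit C))"

text \<open>
  In \<open>counit_hom\<close> the unit object carries its canonical algebra structure, with multiplication
  the unit constraint \<open>1 \<odot> 1 \<rightarrow> 1\<close> and unit the identity.
\<close>

locale hopf_algebra = symmetric_monoidal_category C
  for C :: "('o, 'a, 'm) smc_data_scheme" (structure) +
  fixes H :: 'o and \<mu> \<eta> \<Delta> \<epsilon> S :: 'a
  assumes algebra: "is_algebra C H \<mu> \<eta>"
    and coalgebra: "is_coalgebra C H \<Delta> \<epsilon>"
    and comult_hom:
      "is_algebra_hom C H \<mu> \<eta> (H \<odot> H) (tensor_mult C H \<mu> H \<mu>) (tensor_unit C \<eta> \<eta>) \<Delta>"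
    and counit_hom:
      "is_algebra_hom C H \<mu> \<eta> (Unit C) (LUnit C (Unit C)) (Id C (Unit C)) \<epsilon>"
    and antipode_in_Hom: "S \<in> Hom C H H"
    and antipode_left: "\<mu> \<cdot> (S \<otimes> Id C H) \<cdot> \<Delta> = \<eta> \<cdot> \<epsilon>"
    and antipode_right: "\<mu> \<cdot> (Id C H \<otimes> S) \<cdot> \<Delta> = \<eta> \<cdot> \<epsilon>"


section \<open>Generated monoidal subcategories closed under weak retraction\<close>

text \<open>
  Since the category need not be strict, the tensor powers of \<open>H\<close> are all the bracketed
  tensor products of copies of \<open>H\<close> and of the unit object; they are the objects of the generated
  subcategory.
\<close>

inductive_set tensor_powers :: "('o, 'a, 'm) smc_data_scheme \<Rightarrow> 'o \<Rightarrow> 'o set"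
  for C :: "('o, 'a, 'm) smc_data_scheme" (structure) and H :: 'o where
  unit: "Unit C \<in> tensor_powers C H"
| base: "H \<in> tensor_powers C H"
| tensor: "\<lbrakk>A \<in> tensor_powers C H; B \<in> tensor_powers C H\<rbrakk> \<Longrightarrow> A \<odot> B \<in> tensor_powers C H"

text \<open>
  The inverses of the constraints are not listed: for a class that is also weakly retraction
  closed they follow, by taking \<open>p\<close> a constraint and \<open>s\<close> its inverse.
\<close>

definition monoidal_subcategory_on ::
  "('o, 'a, 'm) smc_data_scheme \<Rightarrow> 'o \<Rightarrow> 'a set \<Rightarrow> bool" where
  "monoidal_subcategory_on C H Y \<longleftrightarrow>
     Y \<subseteq> Arr C \<and>
     (\<forall>A \<in> tensor_powers C H. Id C A \<in> Y \<and> LUnit C A \<in> Y \<and> RUnit C A \<in> Y) \<and>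
     (\<forall>A \<in> tensor_powers C H. \<forall>B \<in> tensor_powers C H. \<forall>D \<in> tensor_powers C H.
        Assoc C A B D \<in> Y) \<and>
     (\<forall>f \<in> Y. \<forall>g \<in> Y. Dom C g = Cod C f \<longrightarrow> g \<cdot>\<^bsub>C\<^esub> f \<in> Y) \<and>
     (\<forall>f \<in> Y. \<forall>g \<in> Y. f \<otimes>\<^bsub>C\<^esub> g \<in> Y)"

definition weakly_retraction_closed :: "('o, 'a, 'm) cat_data_scheme \<Rightarrow> 'a set \<Rightarrow> bool" where
  "weakly_retraction_closed C Y \<longleftrightarrow>
     (\<forall>A \<in> Obj C. \<forall>B \<in> Obj C. \<forall>s \<in> Hom C A B. \<forall>p \<in> Hom C B A.
        p \<cdot>\<^bsub>C\<^esub> s = Id C A \<and> s \<cdot>\<^bsub>C\<^esub> p \<in> Y \<longrightarrow> (s \<in> Y \<longleftrightarrow> p \<in> Y))"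

definition generated_subcategory ::
  "('o, 'a, 'm) smc_data_scheme \<Rightarrow> 'o \<Rightarrow> 'a set \<Rightarrow> 'a set" where
  "generated_subcategory C H X =
     \<Inter> {Y. X \<subseteq> Y \<and> monoidal_subcategory_on C H Y \<and> weakly_retraction_closed C Y}"

lemma (in monoidal_category) tensor_powers_in_Obj:
  assumes "H \<in> Obj C" and "A \<in> tensor_powers C H"
  shows "A \<in> Obj C"
  using assms(2) by induction (auto intro: Unit_in_Obj assms(1) OTensor_in_Obj)

lemma (in monoidal_category) Arr_closed:
  assumes "H \<in> Obj C"
  shows "monoidal_subcategory_on C H (Arr C)" and "weakly_retraction_closed C (Arr C)"
proof -
  have T: "f \<in> Hom C (Dom C f) (Cod C f)" if "f \<in> Arr C" for f
    using that by (simp add: Hom_def)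
  have H: "f \<in> Arr C" if "f \<in> Hom C A B" for f A B
    using that by (simp add: Hom_def)
  note obj = tensor_powers_in_Obj[OF assms]
  have "g \<cdot> f \<in> Arr C" if "f \<in> Arr C" "g \<in> Arr C" "Dom C g = Cod C f" for f g
    using H[OF Comp_in_Hom[OF T[OF that(1)]]] T[OF that(2)] that(3) by simp
  moreover have "f \<otimes> g \<in> Arr C" if "f \<in> Arr C" "g \<in> Arr C" for f g
    by (rule H[OF Tensor_in_Hom[OF T[OF that(1)] T[OF that(2)]]])
  ultimately show "monoidal_subcategory_on C H (Arr C)"
    unfolding monoidal_subcategory_on_def
    using H[OF Id_in_Hom[OF obj]] H[OF LUnit_in_Hom[OF obj]] H[OF RUnit_in_Hom[OF obj]]
      H[OF Assoc_in_Hom[OF obj obj obj]]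
    by simp
  show "weakly_retraction_closed C (Arr C)"
    by (auto simp: weakly_retraction_closed_def Hom_def)
qed

text \<open>The intersection is itself a class of the required kind, hence the smallest one.\<close>

lemma (in monoidal_category) generated_subcategory_least:
  assumes "H \<in> Obj C" and "X \<subseteq> Arr C"
  shows "X \<subseteq> generated_subcategory C H X"
    and "monoidal_subcategory_on C H (generated_subcategory C H X)"
    and "weakly_retraction_closed C (generated_subcategory C H X)"
    and "\<lbrakk>X \<subseteq> Y; monoidal_subcategory_on C H Y; weakly_retraction_closed C Y\<rbrakk>
         \<Longrightarrow> generated_subcategory C H X \<subseteq> Y"
proof -
  let ?F = "{Y. X \<subseteq> Y \<and> monoidal_subcategory_on C H Y \<and> weakly_retraction_closed C Y}"
  have "Arr C \<in> ?F"
    using assms Arr_closed by simp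
  then have sub: "\<Inter> ?F \<subseteq> Arr C"
    by (rule Inter_lower)
  show "X \<subseteq> generated_subcategory C H X"
    by (auto simp: generated_subcategory_def)
  show "monoidal_subcategory_on C H (generated_subcategory C H X)"
    using sub by (simp add: generated_subcategory_def monoidal_subcategory_on_def)
  have iff: "s \<in> \<Inter> ?F \<longleftrightarrow> p \<in> \<Inter> ?F"
    if "A \<in> Obj C" "B \<in> Obj C" "s \<in> Hom C A B" "p \<in> Hom C B A" "p \<cdot> s = Id C A" "s \<cdot> p \<in> \<Inter> ?F"
    for A B s p
  proof -
    have "s \<in> Y \<longleftrightarrow> p \<in> Y" if "Y \<in> ?F" for Y
    proof -
      have "weakly_retraction_closed C Y" and "s \<cdot> p \<in> Y"
        using \<open>Y \<in> ?F\<close> \<open>s \<cdot> p \<in> \<Inter> ?F\<close> by auto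
      then show ?thesis
        using \<open>A \<in> Obj C\<close> \<open>B \<in> Obj C\<close> \<open>s \<in> Hom C A B\<close> \<open>p \<in> Hom C B A\<close> \<open>p \<cdot> s = Id C A\<close>
        by (simp add: weakly_retraction_closed_def)
    qed
    then show ?thesis
      by (simp only: Inter_iff cong: ball_cong)
  qed
  show "weakly_retraction_closed C (generated_subcategory C H X)"
    unfolding weakly_retraction_closed_def[of C "generated_subcategory C H X"]
    unfolding generated_subcategory_def
    by (intro ballI impI, elim conjE) (rule iff)
  show "generated_subcategory C H X \<subseteq> Y"
    if "X \<subseteq> Y" "monoidal_subcategory_on C H Y" "weakly_retraction_closed C Y"
    using that by (auto simp: generated_subcategory_def)
qed

end

theory Submission
  imports Defs
begin

text \<open>
  Let \<open>T\<close> be the functor \<open>H \<odot> -\<close>. The structure maps of \<open>H\<close> become natural transformations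
  between powers of \<open>T\<close>, and as composition of functors is strictly associative, the Hopf algebra
  laws can be used in this form without associativity constraints.

  The map \<open>x \<otimes> y \<mapsto> x y\<^sub>1 \<otimes> y\<^sub>2\<close> lies in the subcategory and is invertible, so its inverse
  \<open>x \<otimes> y \<mapsto> x S(y\<^sub>1) \<otimes> y\<^sub>2\<close> lies there too. From it and either of \<open>\<eta>\<close> and \<open>\<epsilon>\<close> one
  obtains \<open>\<eta> \<epsilon>\<close>; as \<open>\<epsilon> \<eta> = id\<close>, weak retraction closure yields the other one, and then \<open>S\<close>. Finally
  \<open>y \<otimes> x = S(x\<^sub>1) (x\<^sub>2 y\<^sub>1) \<otimes> (x\<^sub>3 y\<^sub>2) S(y\<^sub>3)\<close>, where the middle part is
  \<open>\<Delta>(x\<^sub>2 y\<^sub>1)\<close>, expresses the flip through \<open>\<mu>\<close>, \<open>\<Delta>\<close> and \<open>S\<close>.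
\<close>

section \<open>Monoidal categories\<close>

context category
begin

lemma HomD:
  assumes "f \<in> Hom C A B"
  shows "f \<in> Arr C" and "Dom C f = A" and "Cod C f = B"
  using assms by (simp_all add: Hom_def)

lemma HomI: "\<lbrakk>f \<in> Arr C; Dom C f = A; Cod C f = B\<rbrakk> \<Longrightarrow> f \<in> Hom C A B"
  by (simp add: Hom_def)

lemma Obj_typing [simp]:
  assumes "f \<in> Arr C"
  shows "Dom C f \<in> Obj C" and "Cod C f \<in> Obj C"
  using assms Dom_in_Obj Cod_in_Obj by auto

lemma Id_typing [simp]:
  assumes "A \<in> Obj C"
  shows "Id C A \<in> Arr C" and "Dom C (Id C A) = A" and "Cod C (Id C A) = A"
  using HomD[OF Id_in_Hom[OF assms]] by auto

lemma Comp_typing [simp]: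
  assumes "f \<in> Arr C" and "g \<in> Arr C" and "Dom C g = Cod C f"
  shows "g \<cdot> f \<in> Arr C" and "Dom C (g \<cdot> f) = Dom C f" and "Cod C (g \<cdot> f) = Cod C g"
  using HomD[OF Comp_in_Hom[OF HomI[OF assms(1) refl refl] HomI[OF assms(2,3) refl]]] by auto

lemma Id_Comp [simp]: "\<lbrakk>f \<in> Arr C; Cod C f = B\<rbrakk> \<Longrightarrow> Id C B \<cdot> f = f"
  by (rule Comp_Id_left[OF HomI[OF _ refl]])

lemma Comp_Id [simp]: "\<lbrakk>f \<in> Arr C; Dom C f = A\<rbrakk> \<Longrightarrow> f \<cdot> Id C A = f"
  by (rule Comp_Id_right[OF HomI[OF _ _ refl]])

lemma Comp_Comp [simp]:
  "\<lbrakk>f \<in> Arr C; g \<in> Arr C; h \<in> Arr C; Dom C g = Cod C f; Dom C h = Cod C g\<rbrakk>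
   \<Longrightarrow> (h \<cdot> g) \<cdot> f = h \<cdot> (g \<cdot> f)"
  by (rule Comp_assoc) (auto intro: HomI)

text \<open>Simplification nests composites to the right, which hides the factor
  \<open>a \<cdot> b\<close> inside a longer composite. The version with a tail \<open>f\<close>
  makes the equation applicable there.\<close>

lemma Comp_extend:
  assumes "a \<cdot> b = c \<cdot> d" and "f \<in> Arr C" and "Cod C f = Dom C b" and "Cod C f = Dom C d"
    and "a \<in> Arr C" "b \<in> Arr C" "c \<in> Arr C" "d \<in> Arr C"
    and "Dom C a = Cod C b" and "Dom C c = Cod C d"
  shows "a \<cdot> (b \<cdot> f) = c \<cdot> (d \<cdot> f)"
  using assms by (simp flip: Comp_Comp)

lemma Comp_extend_single:
  assumes "a \<cdot> b = c" and "f \<in> Arr C" and "Cod C f = Dom C b"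
    and "a \<in> Arr C" "b \<in> Arr C" and "Dom C a = Cod C b"
  shows "a \<cdot> (b \<cdot> f) = c \<cdot> f"
  using assms by (simp flip: Comp_Comp)

lemma inverse_arrows_unique:
  assumes "inverse_arrows C f g" and "inverse_arrows C f h"
  shows "g = h"
proof -
  have "h = (g \<cdot> f) \<cdot> h"
    using assms by (simp add: inverse_arrows_def Hom_def)
  also have "\<dots> = g \<cdot> (f \<cdot> h)"
    using assms by (intro Comp_Comp) (auto simp: inverse_arrows_def Hom_def)
  also have "\<dots> = g"
    using assms by (simp add: inverse_arrows_def Hom_def)
  finally show ?thesis by simp
qed

lemma Inv_inverse: "is_iso C f \<Longrightarrow> inverse_arrows C f (Inv C f)"
  unfolding is_iso_def Inv_def by (rule theI') (auto intro: inverse_arrows_unique)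

lemma Inv_eqI: "inverse_arrows C f g \<Longrightarrow> Inv C f = g"
  by (rule inverse_arrows_unique[OF Inv_inverse]) (auto simp: is_iso_def)

lemma Inv_typing:
  assumes "is_iso C f"
  shows "Inv C f \<in> Arr C" and "Dom C (Inv C f) = Cod C f" and "Cod C (Inv C f) = Dom C f"
  using Inv_inverse[OF assms] by (auto simp: inverse_arrows_def Hom_def)

lemma Inv_cancel:
  assumes "is_iso C f"
  shows "Inv C f \<cdot> f = Id C (Dom C f)" and "f \<cdot> Inv C f = Id C (Cod C f)"
  using Inv_inverse[OF assms] by (auto simp: inverse_arrows_def)

lemma iso_typing: "is_iso C f \<Longrightarrow> f \<in> Arr C"
  by (auto simp: is_iso_def inverse_arrows_def)

lemma Inv_Comp_cancel:
  assumes "is_iso C f" and "g \<in> Arr C"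
  shows "Cod C g = Dom C f \<Longrightarrow> Inv C f \<cdot> (f \<cdot> g) = g"
    and "Cod C g = Cod C f \<Longrightarrow> f \<cdot> (Inv C f \<cdot> g) = g"
  using assms Inv_typing[OF assms(1)] Inv_cancel[OF assms(1)] iso_typing[OF assms(1)]
  by (simp_all flip: Comp_Comp)

lemma iso_cancel_right:
  assumes "is_iso C f" and "g \<cdot> f = h \<cdot> f"
    and "g \<in> Arr C" "h \<in> Arr C" and "Dom C g = Cod C f" and "Dom C h = Cod C f"
  shows "g = h"
proof -
  note types = Inv_typing[OF assms(1)] iso_typing[OF assms(1)] Inv_cancel[OF assms(1)]
  have "g = g \<cdot> (f \<cdot> Inv C f)"
    using assms(3,5) types by simp
  also have "\<dots> = h \<cdot> (f \<cdot> Inv C f)"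
    by (rule Comp_extend[OF assms(2)]) (use assms(3-) types in simp_all)
  also have "\<dots> = h"
    using assms(4,6) types by simp
  finally show ?thesis .
qed

lemma iso_cancel_left:
  assumes "is_iso C f" and "f \<cdot> g = f \<cdot> h"
    and "g \<in> Arr C" "h \<in> Arr C" and "Cod C g = Dom C f" and "Cod C h = Dom C f"
  shows "g = h"
proof -
  have "g = Inv C f \<cdot> (f \<cdot> g)"
    by (rule Inv_Comp_cancel(1)[OF assms(1,3,5), symmetric])
  also have "\<dots> = h"
    unfolding assms(2) by (rule Inv_Comp_cancel(1)[OF assms(1,4,6)])
  finally show ?thesis .
qed

text \<open>Conjugation by the two isomorphisms transfers naturality from a constraint to its
  inverse.\<close>

lemma Inv_square:
  assumes "is_iso C a" and "is_iso C b" and "a \<cdot> f = g \<cdot> b"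
    and "f \<in> Arr C" "g \<in> Arr C" and "Cod C f = Dom C a" and "Dom C g = Cod C b"
  shows "f \<cdot> Inv C b = Inv C a \<cdot> g"
proof -
  note types = Inv_typing[OF assms(1)] Inv_typing[OF assms(2)] iso_typing[OF assms(1)]
    iso_typing[OF assms(2)]
  \<comment> \<open>The hypotheses leave \<open>Dom C f\<close> and \<open>Cod C g\<close> open;
    comparing the ends of both sides of the square determines them.\<close>
  have dom: "Dom C f = Dom C b"
    using arg_cong[OF assms(3), of "Dom C"] Comp_typing(2)[of f a] Comp_typing(2)[of b g]
      assms(4-) types by simp
  have cod: "Cod C g = Cod C a"
    using arg_cong[OF assms(3), of "Cod C"] Comp_typing(3)[of f a] Comp_typing(3)[of b g]
      assms(4-) types by simp
  have "a \<cdot> (f \<cdot> Inv C b) = g \<cdot> (b \<cdot> Inv C b)"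
    by (rule Comp_extend[OF assms(3)]) (use assms(4-) types dom in simp_all)
  also have "\<dots> = g"
    using Inv_cancel(2)[OF assms(2)] assms(4-) types by simp
  also have "g = a \<cdot> (Inv C a \<cdot> g)"
    using Inv_Comp_cancel(2)[OF assms(1,5) cod] by simp
  finally show ?thesis
    by (rule iso_cancel_left[OF assms(1)]) (use assms(4-) types dom cod in simp_all)
qed

end

section \<open>Constraints, their inverses and coherence\<close>

context monoidal_category
begin

abbreviation assoc_inv :: "'o \<Rightarrow> 'o \<Rightarrow> 'o \<Rightarrow> 'a" where
  "assoc_inv A B D \<equiv> Inv C (Assoc C A B D)"

declare OTensor_in_Obj [simp] Unit_in_Obj [simp] Assoc_iso [simp] LUnit_iso [simp] RUnit_iso [simp]

lemma Tensor_typing [simp]: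
  assumes "f \<in> Arr C" and "g \<in> Arr C"
  shows "f \<otimes> g \<in> Arr C" and "Dom C (f \<otimes> g) = Dom C f \<odot> Dom C g"
    and "Cod C (f \<otimes> g) = Cod C f \<odot> Cod C g"
  using HomD[OF Tensor_in_Hom[OF HomI[OF assms(1) refl refl] HomI[OF assms(2) refl refl]]] by auto

lemma Assoc_typing [simp]:
  assumes "A \<in> Obj C" and "B \<in> Obj C" and "D \<in> Obj C"
  shows "Assoc C A B D \<in> Arr C" and "Dom C (Assoc C A B D) = (A \<odot> B) \<odot> D"
    and "Cod C (Assoc C A B D) = A \<odot> (B \<odot> D)"
    and "assoc_inv A B D \<in> Arr C" and "Dom C (assoc_inv A B D) = A \<odot> (B \<odot> D)"
    and "Cod C (assoc_inv A B D) = (A \<odot> B) \<odot> D"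
  using HomD[OF Assoc_in_Hom[OF assms]] Inv_typing[OF Assoc_iso[OF assms]] by auto

lemma LUnit_typing [simp]:
  assumes "A \<in> Obj C"
  shows "LUnit C A \<in> Arr C" and "Dom C (LUnit C A) = Unit C \<odot> A" and "Cod C (LUnit C A) = A"
    and "Inv C (LUnit C A) \<in> Arr C" and "Dom C (Inv C (LUnit C A)) = A"
    and "Cod C (Inv C (LUnit C A)) = Unit C \<odot> A"
  using HomD[OF LUnit_in_Hom[OF assms]] Inv_typing[OF LUnit_iso[OF assms]] by auto

lemma RUnit_typing [simp]:
  assumes "A \<in> Obj C"
  shows "RUnit C A \<in> Arr C" and "Dom C (RUnit C A) = A \<odot> Unit C" and "Cod C (RUnit C A) = A"
    and "Inv C (RUnit C A) \<in> Arr C" and "Dom C (Inv C (RUnit C A)) = A"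
    and "Cod C (Inv C (RUnit C A)) = A \<odot> Unit C"
  using HomD[OF RUnit_in_Hom[OF assms]] Inv_typing[OF RUnit_iso[OF assms]] by auto

lemma Assoc_cancel [simp]:
  assumes "A \<in> Obj C" and "B \<in> Obj C" and "D \<in> Obj C"
  shows "assoc_inv A B D \<cdot> Assoc C A B D = Id C ((A \<odot> B) \<odot> D)"
    and "Assoc C A B D \<cdot> assoc_inv A B D = Id C (A \<odot> (B \<odot> D))"
    and "\<lbrakk>g \<in> Arr C; Cod C g = (A \<odot> B) \<odot> D\<rbrakk> \<Longrightarrow> assoc_inv A B D \<cdot> (Assoc C A B D \<cdot> g) = g"
    and "\<lbrakk>g \<in> Arr C; Cod C g = A \<odot> (B \<odot> D)\<rbrakk> \<Longrightarrow> Assoc C A B D \<cdot> (assoc_inv A B D \<cdot> g) = g"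
  using assms by (simp_all add: Inv_cancel Inv_Comp_cancel)

lemma LUnit_cancel [simp]:
  assumes "A \<in> Obj C"
  shows "Inv C (LUnit C A) \<cdot> LUnit C A = Id C (Unit C \<odot> A)"
    and "LUnit C A \<cdot> Inv C (LUnit C A) = Id C A"
    and "\<lbrakk>g \<in> Arr C; Cod C g = Unit C \<odot> A\<rbrakk> \<Longrightarrow> Inv C (LUnit C A) \<cdot> (LUnit C A \<cdot> g) = g"
    and "\<lbrakk>g \<in> Arr C; Cod C g = A\<rbrakk> \<Longrightarrow> LUnit C A \<cdot> (Inv C (LUnit C A) \<cdot> g) = g"
  using assms by (simp_all add: Inv_cancel Inv_Comp_cancel)

lemma RUnit_cancel [simp]: "A \<in> Obj C \<Longrightarrow> RUnit C A \<cdot> Inv C (RUnit C A) = Id C A"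
  by (simp add: Inv_cancel)

text \<open>The interchange law is oriented towards a single tensor, so that \<open>fuse\<close>
  collects composites inside one factor, where a law of \<open>H\<close> can then be
  applied.\<close>

lemma Tensor_fuse:
  "\<lbrakk>f \<in> Arr C; f' \<in> Arr C; g \<in> Arr C; g' \<in> Arr C; Dom C f' = Cod C f; Dom C g' = Cod C g\<rbrakk>
   \<Longrightarrow> (f' \<otimes> g') \<cdot> (f \<otimes> g) = (f' \<cdot> f) \<otimes> (g' \<cdot> g)"
  by (rule Tensor_Comp[symmetric]) (auto intro: HomI)

lemma Tensor_fuse_extend:
  "\<lbrakk>f \<in> Arr C; f' \<in> Arr C; g \<in> Arr C; g' \<in> Arr C; Dom C f' = Cod C f; Dom C g' = Cod C g;
    h \<in> Arr C; Cod C h = Dom C f \<odot> Dom C g\<rbrakk>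
   \<Longrightarrow> (f' \<otimes> g') \<cdot> ((f \<otimes> g) \<cdot> h) = ((f' \<cdot> f) \<otimes> (g' \<cdot> g)) \<cdot> h"
  by (simp add: Tensor_fuse flip: Comp_Comp)

lemmas fuse = Tensor_fuse Tensor_fuse_extend

lemma Assoc_nat:
  "\<lbrakk>f \<in> Arr C; g \<in> Arr C; h \<in> Arr C\<rbrakk>
   \<Longrightarrow> Assoc C (Cod C f) (Cod C g) (Cod C h) \<cdot> ((f \<otimes> g) \<otimes> h) =
       (f \<otimes> (g \<otimes> h)) \<cdot> Assoc C (Dom C f) (Dom C g) (Dom C h)"
  by (intro Assoc_natural HomI refl)

lemma assoc_inv_nat:
  "\<lbrakk>f \<in> Arr C; g \<in> Arr C; h \<in> Arr C\<rbrakk>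
   \<Longrightarrow> ((f \<otimes> g) \<otimes> h) \<cdot> assoc_inv (Dom C f) (Dom C g) (Dom C h) =
       assoc_inv (Cod C f) (Cod C g) (Cod C h) \<cdot> (f \<otimes> (g \<otimes> h))"
  by (rule Inv_square) (simp_all add: Assoc_nat)

lemma LUnit_nat: "f \<in> Arr C \<Longrightarrow> LUnit C (Cod C f) \<cdot> (Id C (Unit C) \<otimes> f) = f \<cdot> LUnit C (Dom C f)"
  by (intro LUnit_natural HomI refl)

lemma LUnit_inv_nat:
  "f \<in> Arr C \<Longrightarrow>
   (Id C (Unit C) \<otimes> f) \<cdot> Inv C (LUnit C (Dom C f)) = Inv C (LUnit C (Cod C f)) \<cdot> f"
  by (rule Inv_square) (simp_all add: LUnit_nat)

lemma RUnit_nat: "f \<in> Arr C \<Longrightarrow> RUnit C (Cod C f) \<cdot> (f \<otimes> Id C (Unit C)) = f \<cdot> RUnit C (Dom C f)"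
  by (intro RUnit_natural HomI refl)

text \<open>By naturality of \<open>LUnit\<close>, \<open>f\<close> and \<open>g\<close> agree after
  precomposition with the isomorphism \<open>LUnit C (Dom C f)\<close>.\<close>

lemma Unit_Tensor_faithful:
  assumes "Id C (Unit C) \<otimes> f = Id C (Unit C) \<otimes> g" and "f \<in> Arr C" "g \<in> Arr C"
    and "Dom C f = Dom C g" and "Cod C f = Cod C g"
  shows "f = g"
  by (rule iso_cancel_right[OF LUnit_iso[of "Dom C f"]])
    (use LUnit_nat[of f] LUnit_nat[of g] assms in simp_all)

lemma Tensor_iso:
  assumes "is_iso C f" and "is_iso C g"
  shows "is_iso C (f \<otimes> g)" and "Inv C (f \<otimes> g) = Inv C f \<otimes> Inv C g"
proof -
  have "inverse_arrows C (f \<otimes> g) (Inv C f \<otimes> Inv C g)"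
    using iso_typing[OF assms(1)] iso_typing[OF assms(2)] Inv_typing[OF assms(1)]
      Inv_typing[OF assms(2)] Inv_cancel[OF assms(1)] Inv_cancel[OF assms(2)]
    by (simp add: inverse_arrows_def fuse HomI Tensor_Id)
  then show "is_iso C (f \<otimes> g)" and "Inv C (f \<otimes> g) = Inv C f \<otimes> Inv C g"
    by (auto simp: is_iso_def Inv_eqI)
qed

lemma Id_iso [simp]: "A \<in> Obj C \<Longrightarrow> is_iso C (Id C A)"
  unfolding is_iso_def inverse_arrows_def by (rule exI[of _ "Id C A"]) (simp add: HomI)

text \<open>Kelly's identity; the pentagon and the triangle give it after tensoring with the unit.\<close>

lemma LUnit_Tensor:
  assumes A: "A \<in> Obj C" and B: "B \<in> Obj C"
  shows "LUnit C (A \<odot> B) \<cdot> Assoc C (Unit C) A B = LUnit C A \<otimes> Id C B"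
proof -
  let ?I = "Unit C" and ?a = "Assoc C (Unit C)"
  let ?P = "?a (?I \<odot> A) B \<cdot> (?a ?I A \<otimes> Id C B)"
  have P: "is_iso C (?a (?I \<odot> A) B)" "is_iso C (?a ?I A \<otimes> Id C B)"
    using A B by (simp_all add: Tensor_iso)
  \<comment> \<open>Both sides are tensored with the unit object and precomposed with
    \<open>?P\<close>, the tail of the pentagon for the objects 1, 1, A, B. The pentagon and the
    triangle for \<open>A \<odot> B\<close> treat one side, naturality and the triangle for
    \<open>A\<close> lead to the other; \<open>?P\<close> is cancelled afterwards.\<close>
  have "((Id C ?I \<otimes> LUnit C (A \<odot> B)) \<cdot> (Id C ?I \<otimes> ?a A B)) \<cdot> ?P
      = (Id C ?I \<otimes> LUnit C (A \<odot> B)) \<cdot> ((Id C ?I \<otimes> ?a A B) \<cdot> ?P)"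
    using A B by (intro Comp_Comp) simp_all
  also have "\<dots> = (Id C ?I \<otimes> LUnit C (A \<odot> B)) \<cdot> ?a ?I (A \<odot> B) \<cdot> Assoc C (?I \<odot> ?I) A B"
    using A B by (simp add: pentagon)
  also have "\<dots> = ((Id C ?I \<otimes> LUnit C (A \<odot> B)) \<cdot> ?a ?I (A \<odot> B)) \<cdot> Assoc C (?I \<odot> ?I) A B"
    using A B by simp
  also have "\<dots> = (RUnit C ?I \<otimes> Id C (A \<odot> B)) \<cdot> Assoc C (?I \<odot> ?I) A B"
    using A B by (simp only: triangle OTensor_in_Obj Unit_in_Obj)
  also have "\<dots> = ?a A B \<cdot> ((RUnit C ?I \<otimes> Id C A) \<otimes> Id C B)"
    using A B Assoc_nat[of "RUnit C ?I" "Id C A" "Id C B"] by (simp add: Tensor_Id)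
  also have "RUnit C ?I \<otimes> Id C A = (Id C ?I \<otimes> LUnit C A) \<cdot> ?a ?I A"
    using A by (simp add: triangle)
  also have "\<dots> \<otimes> Id C B = ((Id C ?I \<otimes> LUnit C A) \<otimes> Id C B) \<cdot> (?a ?I A \<otimes> Id C B)"
    using A B by (simp add: fuse)
  also have "?a A B \<cdot> \<dots> = (?a A B \<cdot> ((Id C ?I \<otimes> LUnit C A) \<otimes> Id C B)) \<cdot> (?a ?I A \<otimes> Id C B)"
    using A B by simp
  also have "?a A B \<cdot> ((Id C ?I \<otimes> LUnit C A) \<otimes> Id C B)
      = (Id C ?I \<otimes> (LUnit C A \<otimes> Id C B)) \<cdot> ?a (?I \<odot> A) B"
    using A B Assoc_nat[of "Id C ?I" "LUnit C A" "Id C B"] by simp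
  also have "\<dots> \<cdot> (?a ?I A \<otimes> Id C B) = (Id C ?I \<otimes> (LUnit C A \<otimes> Id C B)) \<cdot> ?P"
    using A B by simp
  finally have "(((Id C ?I \<otimes> LUnit C (A \<odot> B)) \<cdot> (Id C ?I \<otimes> ?a A B)) \<cdot> ?a (?I \<odot> A) B) \<cdot> (?a ?I A \<otimes> Id C B)
      = ((Id C ?I \<otimes> (LUnit C A \<otimes> Id C B)) \<cdot> ?a (?I \<odot> A) B) \<cdot> (?a ?I A \<otimes> Id C B)"
    using A B by simp
  then have "((Id C ?I \<otimes> LUnit C (A \<odot> B)) \<cdot> (Id C ?I \<otimes> ?a A B)) \<cdot> ?a (?I \<odot> A) B
      = (Id C ?I \<otimes> (LUnit C A \<otimes> Id C B)) \<cdot> ?a (?I \<odot> A) B"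
    by (rule iso_cancel_right[OF P(2)]) (simp_all add: A B)
  then have "(Id C ?I \<otimes> LUnit C (A \<odot> B)) \<cdot> (Id C ?I \<otimes> ?a A B)
      = Id C ?I \<otimes> (LUnit C A \<otimes> Id C B)"
    by (rule iso_cancel_right[OF P(1)]) (simp_all add: A B)
  then show ?thesis
    using A B by (intro Unit_Tensor_faithful[where f = \<open>LUnit C (A \<odot> B) \<cdot> ?a A B\<close>]) (simp_all add: fuse)
qed

text \<open>This is the shape in which the inverse associators of two nested multiplications
  meet.\<close>

lemma pentagon_inv:
  assumes [simp]: "A \<in> Obj C" "B \<in> Obj C" "D \<in> Obj C" "E \<in> Obj C"
  shows "assoc_inv A (B \<odot> D) E \<cdot> (Id C A \<otimes> assoc_inv B D E) =
    (Assoc C A B D \<otimes> Id C E) \<cdot> assoc_inv (A \<odot> B) D E \<cdot> assoc_inv A B (D \<odot> E)"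
    (is "?L = ?R")
proof -
  let ?P = "Assoc C A B (D \<odot> E) \<cdot> Assoc C (A \<odot> B) D E"
  let ?Q = "(Id C A \<otimes> Assoc C B D E) \<cdot> Assoc C A (B \<odot> D) E \<cdot> (Assoc C A B D \<otimes> Id C E)"
  \<comment> \<open>\<open>?P\<close> is inserted together with its inverse; once the pentagon
    replaces it by \<open>?Q\<close>, the first two factors of \<open>?Q\<close> cancel against
    \<open>?L\<close>.\<close>
  have "?L = (?L \<cdot> ?P) \<cdot> (assoc_inv (A \<odot> B) D E \<cdot> assoc_inv A B (D \<odot> E))"
    by simp
  also have "?P = ?Q"
    by (simp add: pentagon)
  also have "?L \<cdot> ?Q = Assoc C A B D \<otimes> Id C E"
    by (simp add: fuse Tensor_Id)
  finally show ?thesis .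
qed

end

section \<open>The structure maps as natural transformations\<close>

context hopf_algebra
begin

lemma H_Obj [simp]: "H \<in> Obj C"
  using algebra by (simp add: is_algebra_def)

lemma structure_typing [simp]:
  "\<mu> \<in> Arr C" "Dom C \<mu> = H \<odot> H" "Cod C \<mu> = H"
  "\<eta> \<in> Arr C" "Dom C \<eta> = Unit C" "Cod C \<eta> = H"
  "\<Delta> \<in> Arr C" "Dom C \<Delta> = H" "Cod C \<Delta> = H \<odot> H"
  "\<epsilon> \<in> Arr C" "Dom C \<epsilon> = H" "Cod C \<epsilon> = Unit C"
  "S \<in> Arr C" "Dom C S = H" "Cod C S = H"
  using algebra coalgebra antipode_in_Hom
  by (simp_all add: is_algebra_def is_coalgebra_def Hom_def)

lemma Sym_typing [simp]:
  "Sym C H H \<in> Arr C" "Dom C (Sym C H H) = H \<odot> H" "Cod C (Sym C H H) = H \<odot> H"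
  using Sym_in_Hom[OF H_Obj H_Obj] by (simp_all add: Hom_def)

definition T :: "'a \<Rightarrow> 'a" where
  "T f = Id C H \<otimes> f"

text \<open>Here and in the next definitions the constraints are built in so that sources and
  targets are \<open>X\<close> with copies of \<open>H\<close> nested on its left; composites then
  fit without rebracketing.\<close>

definition mult :: "'o \<Rightarrow> 'a" where
  "mult X = (\<mu> \<otimes> Id C X) \<cdot> assoc_inv H H X"

definition unit :: "'o \<Rightarrow> 'a" where
  "unit X = (\<eta> \<otimes> Id C X) \<cdot> Inv C (LUnit C X)"

definition comult :: "'o \<Rightarrow> 'a" where
  "comult X = Assoc C H H X \<cdot> (\<Delta> \<otimes> Id C X)"

definition counit :: "'o \<Rightarrow> 'a" where
  "counit X = LUnit C X \<cdot> (\<epsilon> \<otimes> Id C X)"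

definition antipode :: "'o \<Rightarrow> 'a" where
  "antipode X = S \<otimes> Id C X"

definition flip :: "'o \<Rightarrow> 'a" where
  "flip X = Assoc C H H X \<cdot> (Sym C H H \<otimes> Id C X) \<cdot> assoc_inv H H X"

lemmas whiskered_defs = T_def mult_def unit_def comult_def counit_def antipode_def flip_def

lemma T_typing [simp]:
  assumes "f \<in> Arr C"
  shows "T f \<in> Arr C" and "Dom C (T f) = H \<odot> Dom C f" and "Cod C (T f) = H \<odot> Cod C f"
  using assms by (simp_all add: T_def)

lemma whiskered_typing [simp]:
  assumes "X \<in> Obj C"
  shows "mult X \<in> Arr C" "Dom C (mult X) = H \<odot> (H \<odot> X)" "Cod C (mult X) = H \<odot> X"
    and "unit X \<in> Arr C" "Dom C (unit X) = X" "Cod C (unit X) = H \<odot> X"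
    and "comult X \<in> Arr C" "Dom C (comult X) = H \<odot> X" "Cod C (comult X) = H \<odot> (H \<odot> X)"
    and "counit X \<in> Arr C" "Dom C (counit X) = H \<odot> X" "Cod C (counit X) = X"
    and "antipode X \<in> Arr C" "Dom C (antipode X) = H \<odot> X" "Cod C (antipode X) = H \<odot> X"
    and "flip X \<in> Arr C" "Dom C (flip X) = H \<odot> (H \<odot> X)" "Cod C (flip X) = H \<odot> (H \<odot> X)"
  using assms by (simp_all add: whiskered_defs)

lemma T_Comp [simp]:
  "\<lbrakk>f \<in> Arr C; g \<in> Arr C; Dom C g = Cod C f\<rbrakk> \<Longrightarrow> T (g \<cdot> f) = T g \<cdot> T f"
  by (simp add: T_def fuse)

lemma T_Id [simp]: "X \<in> Obj C \<Longrightarrow> T (Id C X) = Id C (H \<odot> X)"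
  by (simp add: T_def Tensor_Id)

text \<open>Each structure map touches only the outer copies of \<open>H\<close> while
  \<open>f\<close> acts on the innermost object, so they commute by interchange, and the built-in
  constraints are natural.\<close>

lemma whiskered_nat:
  assumes "f \<in> Arr C" and "Dom C f = X" and "Cod C f = Y"
  shows mult_nat: "T f \<cdot> mult X = mult Y \<cdot> T (T f)"
    and unit_nat: "T f \<cdot> unit X = unit Y \<cdot> f"
    and comult_nat: "T (T f) \<cdot> comult X = comult Y \<cdot> T f"
    and antipode_nat: "T f \<cdot> antipode X = antipode Y \<cdot> T f"
    and flip_nat: "T (T f) \<cdot> flip X = flip Y \<cdot> T (T f)"
proof -
  have [simp]: "X \<in> Obj C" "Y \<in> Obj C"
    using assms by auto
  note f = assms
  have a: "(Id C H \<otimes> (Id C H \<otimes> f)) \<cdot> Assoc C H H X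
      = Assoc C H H Y \<cdot> (Id C (H \<odot> H) \<otimes> f)"
    using Assoc_nat[of "Id C H" "Id C H" f] f by (simp add: Tensor_Id)
  have ai: "assoc_inv H H Y \<cdot> (Id C H \<otimes> (Id C H \<otimes> f))
      = (Id C (H \<odot> H) \<otimes> f) \<cdot> assoc_inv H H X"
    using assoc_inv_nat[of "Id C H" "Id C H" f] f by (simp add: Tensor_Id)
  have l: "Inv C (LUnit C Y) \<cdot> f = (Id C (Unit C) \<otimes> f) \<cdot> Inv C (LUnit C X)"
    using LUnit_inv_nat[of f] f by simp
  show "T f \<cdot> mult X = mult Y \<cdot> T (T f)"
    using f by (simp add: whiskered_defs ai fuse)
  show "T f \<cdot> unit X = unit Y \<cdot> f"
    using f by (simp add: whiskered_defs l fuse)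
  have "T (T f) \<cdot> comult X = ((Id C H \<otimes> (Id C H \<otimes> f)) \<cdot> Assoc C H H X) \<cdot> (\<Delta> \<otimes> Id C X)"
    using f by (simp add: whiskered_defs)
  also have "\<dots> = comult Y \<cdot> T f"
    unfolding a using f by (simp add: whiskered_defs fuse)
  finally show "T (T f) \<cdot> comult X = comult Y \<cdot> T f" .
  show "T f \<cdot> antipode X = antipode Y \<cdot> T f"
    using f by (simp add: whiskered_defs fuse)
  have "T (T f) \<cdot> flip X
      = ((Id C H \<otimes> (Id C H \<otimes> f)) \<cdot> Assoc C H H X) \<cdot> ((Sym C H H \<otimes> Id C X) \<cdot> assoc_inv H H X)"
    using f by (simp add: whiskered_defs)
  also have "\<dots> = flip Y \<cdot> T (T f)"
    unfolding a using f by (simp add: whiskered_defs fuse ai)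
  finally show "T (T f) \<cdot> flip X = flip Y \<cdot> T (T f)" .
qed

section \<open>Unit, counit and antipode laws in whiskered form\<close>

context
  fixes X
  assumes X [simp]: "X \<in> Obj C"
begin

text \<open>The right unit law leaves \<open>RUnit C H \<otimes> Id C X\<close>, which the triangle
  converts into the left unit constraint contained in \<open>unit X\<close>.\<close>

lemma mult_unit_right: "mult X \<cdot> T (unit X) = Id C (H \<odot> X)"
proof -
  have eq: "assoc_inv H H X \<cdot> (Id C H \<otimes> (\<eta> \<otimes> Id C X))
      = ((Id C H \<otimes> \<eta>) \<otimes> Id C X) \<cdot> assoc_inv H (Unit C) X"
    using assoc_inv_nat[of "Id C H" \<eta> "Id C X"] by simp
  have "mult X \<cdot> T (unit X)
      = (\<mu> \<otimes> Id C X) \<cdot> (((Id C H \<otimes> \<eta>) \<otimes> Id C X) \<cdot> assoc_inv H (Unit C) X)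
        \<cdot> (Id C H \<otimes> Inv C (LUnit C X))"
    by (simp add: mult_def unit_def) (simp add: T_def Comp_extend[OF eq])
  also have "\<dots> = 
        ((\<mu> \<cdot> (Id C H \<otimes> \<eta>)) \<otimes> Id C X) \<cdot> (assoc_inv H (Unit C) X \<cdot> (Id C H \<otimes> Inv C (LUnit C X)))"
    by (simp add: fuse)
  also have "\<mu> \<cdot> (Id C H \<otimes> \<eta>) = RUnit C H"
    using algebra by (simp add: is_algebra_def)
  also have "RUnit C H \<otimes> Id C X = (Id C H \<otimes> LUnit C X) \<cdot> Assoc C H (Unit C) X"
    by (simp add: triangle)
  finally show ?thesis
    by (simp add: fuse Tensor_Id)
qed

text \<open>The left unit law leaves \<open>LUnit C H \<otimes> Id C X\<close>; Kelly's identity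
  absorbs the remaining associator.\<close>

lemma mult_unit_left: "mult X \<cdot> unit (H \<odot> X) = Id C (H \<odot> X)"
proof -
  have eq: "assoc_inv H H X \<cdot> (\<eta> \<otimes> Id C (H \<odot> X))
      = ((\<eta> \<otimes> Id C H) \<otimes> Id C X) \<cdot> assoc_inv (Unit C) H X"
    using assoc_inv_nat[of \<eta> "Id C H" "Id C X"] by (simp add: Tensor_Id)
  have "mult X \<cdot> unit (H \<odot> X)
      = (\<mu> \<otimes> Id C X) \<cdot> (((\<eta> \<otimes> Id C H) \<otimes> Id C X) \<cdot> assoc_inv (Unit C) H X)
        \<cdot> Inv C (LUnit C (H \<odot> X))"
    by (simp add: mult_def unit_def) (simp add: T_def Comp_extend[OF eq])
  also have "\<dots> = ((\<mu> \<cdot> (\<eta> \<otimes> Id C H)) \<otimes> Id C X) \<cdot> (assoc_inv (Unit C) H X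
        \<cdot> Inv C (LUnit C (H \<odot> X)))"
    by (simp add: fuse)
  also have "\<mu> \<cdot> (\<eta> \<otimes> Id C H) = LUnit C H"
    using algebra by (simp add: is_algebra_def)
  also have "LUnit C H \<otimes> Id C X = LUnit C (H \<odot> X) \<cdot> Assoc C (Unit C) H X"
    by (simp add: LUnit_Tensor)
  finally show ?thesis
    by simp
qed

text \<open>Naturality moves \<epsilon> across the associator, and Kelly's identity then exposes the
  counit law of \<open>H\<close>. The right-hand law uses the triangle instead.\<close>

lemma counit_comult_left: "counit (H \<odot> X) \<cdot> comult X = Id C (H \<odot> X)"
proof -
  have eq: "(\<epsilon> \<otimes> Id C (H \<odot> X)) \<cdot> Assoc C H H X
      = Assoc C (Unit C) H X \<cdot> ((\<epsilon> \<otimes> Id C H) \<otimes> Id C X)"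
    using Assoc_nat[of \<epsilon> "Id C H" "Id C X"] by (simp add: Tensor_Id)
  have "counit (H \<odot> X) \<cdot> comult X = LUnit C (H \<odot> X)
      \<cdot> (Assoc C (Unit C) H X \<cdot> ((\<epsilon> \<otimes> Id C H) \<otimes> Id C X)) \<cdot> (\<Delta> \<otimes> Id C X)"
    by (simp add: counit_def comult_def) (simp add: T_def Comp_extend[OF eq])
  also have "\<dots> = (LUnit C (H \<odot> X) \<cdot> Assoc C (Unit C) H X) \<cdot> (((\<epsilon> \<otimes> Id C H) \<cdot> \<Delta>) \<otimes> Id C X)"
    by (simp add: fuse)
  also have "\<dots> = (LUnit C H \<cdot> (\<epsilon> \<otimes> Id C H) \<cdot> \<Delta>) \<otimes> Id C X"
    unfolding LUnit_Tensor[OF H_Obj X] by (simp add: fuse)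
  also have "LUnit C H \<cdot> (\<epsilon> \<otimes> Id C H) \<cdot> \<Delta> = Id C H"
    using coalgebra by (simp add: is_coalgebra_def)
  finally show ?thesis
    by (simp add: Tensor_Id)
qed

lemma counit_comult_right: "T (counit X) \<cdot> comult X = Id C (H \<odot> X)"
proof -
  have eq: "(Id C H \<otimes> (\<epsilon> \<otimes> Id C X)) \<cdot> Assoc C H H X
      = Assoc C H (Unit C) X \<cdot> ((Id C H \<otimes> \<epsilon>) \<otimes> Id C X)"
    using Assoc_nat[of "Id C H" \<epsilon> "Id C X"] by simp
  have "T (counit X) \<cdot> comult X = (Id C H \<otimes> LUnit C X)
      \<cdot> (Assoc C H (Unit C) X \<cdot> ((Id C H \<otimes> \<epsilon>) \<otimes> Id C X)) \<cdot> (\<Delta> \<otimes> Id C X)"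
    by (simp add: counit_def comult_def) (simp add: T_def Comp_extend[OF eq])
  also have "\<dots> = ((Id C H \<otimes> LUnit C X) \<cdot> Assoc C H (Unit C) X) \<cdot> (((Id C H \<otimes> \<epsilon>) \<cdot> \<Delta>) \<otimes> Id C X)"
    by (simp add: fuse)
  also have "\<dots> = (RUnit C H \<cdot> (Id C H \<otimes> \<epsilon>) \<cdot> \<Delta>) \<otimes> Id C X"
    unfolding triangle[OF H_Obj X] by (simp add: fuse)
  also have "RUnit C H \<cdot> (Id C H \<otimes> \<epsilon>) \<cdot> \<Delta> = Id C H"
    using coalgebra by (simp add: is_coalgebra_def)
  finally show ?thesis
    by (simp add: Tensor_Id)
qed

text \<open>Rests on \<epsilon> preserving the unit. It exhibits \<open>unit X\<close> as a section
  of \<open>counit X\<close>, as weak retraction closure requires.\<close>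

lemma counit_unit: "counit X \<cdot> unit X = Id C X"
proof -
  have "counit X \<cdot> unit X = LUnit C X \<cdot> ((\<epsilon> \<cdot> \<eta>) \<otimes> Id C X) \<cdot> Inv C (LUnit C X)"
    by (simp add: whiskered_defs fuse)
  also have "\<epsilon> \<cdot> \<eta> = Id C (Unit C)"
    using counit_hom by (simp add: is_algebra_hom_def)
  finally show ?thesis
    by (simp add: Tensor_Id)
qed

lemma unit_counit: "unit X \<cdot> counit X = (\<eta> \<cdot> \<epsilon>) \<otimes> Id C X"
  by (simp add: whiskered_defs fuse)

text \<open>The associator of \<open>comult X\<close> slides past \<open>S\<close> by naturality and
  cancels its inverse in \<open>mult X\<close>, leaving the antipode law tensored with
  \<open>X\<close>.\<close>

lemma antipode_left_whiskered: "mult X \<cdot> antipode (H \<odot> X) \<cdot> comult X = unit X \<cdot> counit X"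
proof -
  have eq: "(S \<otimes> Id C (H \<odot> X)) \<cdot> Assoc C H H X = Assoc C H H X \<cdot> ((S \<otimes> Id C H) \<otimes> Id C X)"
    using Assoc_nat[of S "Id C H" "Id C X"] by (simp add: Tensor_Id)
  have "mult X \<cdot> antipode (H \<odot> X) \<cdot> comult X = (\<mu> \<otimes> Id C X) \<cdot> assoc_inv H H X
      \<cdot> (Assoc C H H X \<cdot> ((S \<otimes> Id C H) \<otimes> Id C X)) \<cdot> (\<Delta> \<otimes> Id C X)"
    by (simp add: mult_def antipode_def comult_def) (simp add: T_def Comp_extend[OF eq])
  also have "\<dots> = (\<mu> \<cdot> (S \<otimes> Id C H) \<cdot> \<Delta>) \<otimes> Id C X"
    by (simp add: fuse)
  finally show ?thesis
    by (simp add: antipode_left unit_counit)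
qed

lemma antipode_right_whiskered: "mult X \<cdot> T (antipode X) \<cdot> comult X = unit X \<cdot> counit X"
proof -
  have eq: "(Id C H \<otimes> (S \<otimes> Id C X)) \<cdot> Assoc C H H X = Assoc C H H X \<cdot> ((Id C H \<otimes> S) \<otimes> Id C X)"
    using Assoc_nat[of "Id C H" S "Id C X"] by simp
  have "mult X \<cdot> T (antipode X) \<cdot> comult X = (\<mu> \<otimes> Id C X) \<cdot> assoc_inv H H X
      \<cdot> (Assoc C H H X \<cdot> ((Id C H \<otimes> S) \<otimes> Id C X)) \<cdot> (\<Delta> \<otimes> Id C X)"
    by (simp add: mult_def antipode_def comult_def) (simp add: T_def Comp_extend[OF eq])
  also have "\<dots> = (\<mu> \<cdot> (Id C H \<otimes> S) \<cdot> \<Delta>) \<otimes> Id C X"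
    by (simp add: fuse)
  finally show ?thesis
    by (simp add: antipode_right unit_counit)
qed

end

text \<open>The product of the algebra \<open>H \<odot> H\<close> is bracketed in pairs, the
  whiskered maps are nested to the right; this constraint translates between the two.\<close>

definition rebracket :: "'o \<Rightarrow> 'a" where
  "rebracket X = T (T (Assoc C H H X)) \<cdot> Assoc C H H ((H \<odot> H) \<odot> X) \<cdot> Assoc C (H \<odot> H) (H \<odot> H) X"

section \<open>Associativity, coassociativity and the bialgebra law in whiskered form\<close>

context
  fixes X
  assumes X [simp]: "X \<in> Obj C"
begin

text \<open>Associativity of \<mu> produces one associator on \<open>H\<close>; the inverted
  pentagon absorbs it into the bracketing of the four factors H, H, H, X.\<close>

lemma mult_assoc: "mult X \<cdot> mult (H \<odot> X) = mult X \<cdot> T (mult X)"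
proof -
  have 1: "assoc_inv H H X \<cdot> (\<mu> \<otimes> Id C (H \<odot> X))
      = ((\<mu> \<otimes> Id C H) \<otimes> Id C X) \<cdot> assoc_inv (H \<odot> H) H X"
    using assoc_inv_nat[of \<mu> "Id C H" "Id C X"] by (simp add: Tensor_Id)
  have 2: "assoc_inv H H X \<cdot> (Id C H \<otimes> (\<mu> \<otimes> Id C X))
      = ((Id C H \<otimes> \<mu>) \<otimes> Id C X) \<cdot> assoc_inv H (H \<odot> H) X"
    using assoc_inv_nat[of "Id C H" \<mu> "Id C X"] by simp
  have "mult X \<cdot> mult (H \<odot> X)
      = ((\<mu> \<cdot> (\<mu> \<otimes> Id C H)) \<otimes> Id C X) \<cdot> assoc_inv (H \<odot> H) H X \<cdot> assoc_inv H H (H \<odot> X)"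
    by (simp add: mult_def Comp_extend[OF 1] fuse)
  also have "\<mu> \<cdot> (\<mu> \<otimes> Id C H) = \<mu> \<cdot> (Id C H \<otimes> \<mu>) \<cdot> Assoc C H H H"
    using algebra by (simp add: is_algebra_def)
  also have "(\<dots> \<otimes> Id C X) \<cdot> assoc_inv (H \<odot> H) H X \<cdot> assoc_inv H H (H \<odot> X)
      = (\<mu> \<otimes> Id C X) \<cdot> ((Id C H \<otimes> \<mu>) \<otimes> Id C X)
        \<cdot> (Assoc C H H H \<otimes> Id C X) \<cdot> assoc_inv (H \<odot> H) H X \<cdot> assoc_inv H H (H \<odot> X)"
    by (simp add: fuse)
  also have "\<dots> = mult X \<cdot> T (mult X)"
    by (simp add: mult_def flip: pentagon_inv) (simp add: T_def Comp_extend[OF 2])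
  finally show ?thesis .
qed

lemma comult_coassoc: "T (comult X) \<cdot> comult X = comult (H \<odot> X) \<cdot> comult X"
proof -
  have 1: "(\<Delta> \<otimes> Id C (H \<odot> X)) \<cdot> Assoc C H H X
      = Assoc C (H \<odot> H) H X \<cdot> ((\<Delta> \<otimes> Id C H) \<otimes> Id C X)"
    using Assoc_nat[of \<Delta> "Id C H" "Id C X"] by (simp add: Tensor_Id)
  have 2: "(Id C H \<otimes> (\<Delta> \<otimes> Id C X)) \<cdot> Assoc C H H X
      = Assoc C H (H \<odot> H) X \<cdot> ((Id C H \<otimes> \<Delta>) \<otimes> Id C X)"
    using Assoc_nat[of "Id C H" \<Delta> "Id C X"] by simp
  have "T (comult X) \<cdot> comult X = (Id C H \<otimes> Assoc C H H X) \<cdot> Assoc C H (H \<odot> H) X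
      \<cdot> (((Id C H \<otimes> \<Delta>) \<cdot> \<Delta>) \<otimes> Id C X)"
    by (simp add: comult_def) (simp add: T_def Comp_extend[OF 2] fuse)
  also have "(Id C H \<otimes> \<Delta>) \<cdot> \<Delta> = Assoc C H H H \<cdot> (\<Delta> \<otimes> Id C H) \<cdot> \<Delta>"
    using coalgebra by (simp add: is_coalgebra_def)
  also have "(Id C H \<otimes> Assoc C H H X) \<cdot> Assoc C H (H \<odot> H) X \<cdot> (\<dots> \<otimes> Id C X)
      = ((Id C H \<otimes> Assoc C H H X) \<cdot> Assoc C H (H \<odot> H) X \<cdot> (Assoc C H H H \<otimes> Id C X))
        \<cdot> (((\<Delta> \<otimes> Id C H) \<cdot> \<Delta>) \<otimes> Id C X)"
    by (simp add: fuse)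
  also have "\<dots> = comult (H \<odot> X) \<cdot> comult X"
    by (simp add: pentagon[symmetric] comult_def) (simp add: Comp_extend[OF 1] fuse)
  finally show ?thesis .
qed

text \<open>Both sides exchange the first two copies of \<open>H\<close>. After precomposition with
  an invertible associator, the pentagon reduces both to \<open>Sym C H H\<close> tensored with
  identities.\<close>

lemma flip_reassoc:
  "flip (H \<odot> X) \<cdot> T (Assoc C H H X) \<cdot> Assoc C H (H \<odot> H) X =
   T (Assoc C H H X) \<cdot> Assoc C H (H \<odot> H) X \<cdot> (flip H \<otimes> Id C X)"
proof (rule iso_cancel_right)
  show "is_iso C (Assoc C H H H \<otimes> Id C X)"
    by (simp add: Tensor_iso)
  have nat: "(Sym C H H \<otimes> Id C (H \<odot> X)) \<cdot> Assoc C (H \<odot> H) H X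
      = Assoc C (H \<odot> H) H X \<cdot> ((Sym C H H \<otimes> Id C H) \<otimes> Id C X)"
    using Assoc_nat[of "Sym C H H" "Id C H" "Id C X"] by (simp add: Tensor_Id)
  have pent: "T (Assoc C H H X) \<cdot> Assoc C H (H \<odot> H) X \<cdot> (Assoc C H H H \<otimes> Id C X) \<cdot> g
      = Assoc C H H (H \<odot> X) \<cdot> Assoc C (H \<odot> H) H X \<cdot> g"
    if "g \<in> Arr C" "Cod C g = ((H \<odot> H) \<odot> H) \<odot> X" for g
    using arg_cong[OF pentagon[of H H H X], of "\<lambda>f. f \<cdot> g"] that by (simp add: T_def)
  have pent': "T (Assoc C H H X) \<cdot> Assoc C H (H \<odot> H) X \<cdot> (Assoc C H H H \<otimes> Id C X)
      = Assoc C H H (H \<odot> X) \<cdot> Assoc C (H \<odot> H) H X"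
    using pentagon[of H H H X] by (simp add: T_def)
  have "(flip (H \<odot> X) \<cdot> T (Assoc C H H X) \<cdot> Assoc C H (H \<odot> H) X) \<cdot> (Assoc C H H H \<otimes> Id C X)
      = Assoc C H H (H \<odot> X) \<cdot> (Sym C H H \<otimes> Id C (H \<odot> X)) \<cdot> Assoc C (H \<odot> H) H X"
    by (simp add: flip_def pent')
  also have "\<dots> = T (Assoc C H H X) \<cdot> Assoc C H (H \<odot> H) X \<cdot> (Assoc C H H H \<otimes> Id C X)
      \<cdot> ((Sym C H H \<otimes> Id C H) \<otimes> Id C X)"
    by (simp add: nat pent)
  also have "\<dots> = (T (Assoc C H H X) \<cdot> Assoc C H (H \<odot> H) X \<cdot> (flip H \<otimes> Id C X))
      \<cdot> (Assoc C H H H \<otimes> Id C X)"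
    by (simp add: flip_def fuse)
  finally show "(flip (H \<odot> X) \<cdot> T (Assoc C H H X) \<cdot> Assoc C H (H \<odot> H) X)
      \<cdot> (Assoc C H H H \<otimes> Id C X)
    = (T (Assoc C H H X) \<cdot> Assoc C H (H \<odot> H) X \<cdot> (flip H \<otimes> Id C X))
      \<cdot> (Assoc C H H H \<otimes> Id C X)" .
qed simp_all

lemma rebracket_typing [simp]:
  "rebracket X \<in> Arr C" "Dom C (rebracket X) = ((H \<odot> H) \<odot> (H \<odot> H)) \<odot> X"
  "Cod C (rebracket X) = H \<odot> (H \<odot> (H \<odot> (H \<odot> X)))"
  by (simp_all add: rebracket_def)

lemma interchange_eq:
  "interchange C H H H H = assoc_inv H H (H \<odot> H) \<cdot> T (flip H) \<cdot> Assoc C H H (H \<odot> H)"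
  by (simp add: interchange_def T_def flip_def)

lemma interchange_typing [simp]:
  "interchange C H H H H \<in> Arr C"
  "Dom C (interchange C H H H H) = (H \<odot> H) \<odot> (H \<odot> H)"
  "Cod C (interchange C H H H H) = (H \<odot> H) \<odot> (H \<odot> H)"
  by (simp_all add: interchange_eq)

text \<open>In right-nested bracketing the middle-four interchange only swaps the second and third
  copies of \<open>H\<close>, hence is a single whiskered flip.\<close>

lemma flip_rebracket:
  "T (flip (H \<odot> X)) \<cdot> rebracket X = rebracket X \<cdot> (interchange C H H H H \<otimes> Id C X)"
proof -
  let ?\<beta> = "T (Assoc C H H X) \<cdot> Assoc C H (H \<odot> H) X"
  let ?\<alpha> = "Assoc C H (H \<odot> (H \<odot> H)) X" and ?\<gamma> = "Assoc C H H (H \<odot> H) \<otimes> Id C X"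
  \<comment> \<open>The pentagon reroutes the rebracketing through
    \<open>(H \<odot> (H \<odot> (H \<odot> H))) \<odot> X\<close>, where the interchange appears as
    \<open>T (flip H) \<otimes> Id C X\<close>.\<close>
  have eq: "rebracket X = T ?\<beta> \<cdot> ?\<alpha> \<cdot> ?\<gamma>"
    using pentagon[of H H "H \<odot> H" X] by (simp add: rebracket_def) (simp add: T_def)
  have nat: "T (flip H \<otimes> Id C X) \<cdot> ?\<alpha> = ?\<alpha> \<cdot> (T (flip H) \<otimes> Id C X)"
    using Assoc_nat[of "Id C H" "flip H" "Id C X"] by (simp add: T_def)
  have "T (flip (H \<odot> X)) \<cdot> rebracket X = T (flip (H \<odot> X) \<cdot> ?\<beta>) \<cdot> ?\<alpha> \<cdot> ?\<gamma>"
    by (simp add: eq)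
  also have "flip (H \<odot> X) \<cdot> ?\<beta> = ?\<beta> \<cdot> (flip H \<otimes> Id C X)"
    using flip_reassoc by simp
  also have "T \<dots> \<cdot> ?\<alpha> \<cdot> ?\<gamma> = T ?\<beta> \<cdot> ?\<alpha> \<cdot> (T (flip H) \<otimes> Id C X) \<cdot> ?\<gamma>"
    by (simp add: Comp_extend[OF nat])
  also have "\<dots> = rebracket X \<cdot> (interchange C H H H H \<otimes> Id C X)"
    by (simp add: eq interchange_eq fuse)
  finally show ?thesis .
qed

lemma rebracket_comult:
  "rebracket X \<cdot> ((\<Delta> \<otimes> \<Delta>) \<otimes> Id C X) = comult (H \<odot> (H \<odot> X)) \<cdot> T (comult X) \<cdot> Assoc C H H X"
proof -
  have 1: "Assoc C (H \<odot> H) (H \<odot> H) X \<cdot> ((\<Delta> \<otimes> \<Delta>) \<otimes> Id C X)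
      = (\<Delta> \<otimes> (\<Delta> \<otimes> Id C X)) \<cdot> Assoc C H H X"
    using Assoc_nat[of \<Delta> \<Delta> "Id C X"] by simp
  have 2: "T (T (Assoc C H H X)) \<cdot> Assoc C H H ((H \<odot> H) \<odot> X)
      = Assoc C H H (H \<odot> (H \<odot> X)) \<cdot> (Id C (H \<odot> H) \<otimes> Assoc C H H X)"
    using Assoc_nat[of "Id C H" "Id C H" "Assoc C H H X"] by (simp add: T_def Tensor_Id)
  show ?thesis
    by (simp add: rebracket_def 1 comult_def Comp_extend[OF 2]) (simp add: T_def fuse)
qed

lemma mult_rebracket:
  "mult (H \<odot> X) \<cdot> T (T (mult X)) \<cdot> rebracket X = Assoc C H H X \<cdot> ((\<mu> \<otimes> \<mu>) \<otimes> Id C X)"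
proof -
  have 1: "T (T (\<mu> \<otimes> Id C X)) \<cdot> Assoc C H H ((H \<odot> H) \<odot> X)
      = Assoc C H H (H \<odot> X) \<cdot> (Id C (H \<odot> H) \<otimes> (\<mu> \<otimes> Id C X))"
    using Assoc_nat[of "Id C H" "Id C H" "\<mu> \<otimes> Id C X"] by (simp add: T_def Tensor_Id)
  have 2: "T (T (mult X)) \<cdot> T (T (Assoc C H H X)) = T (T (\<mu> \<otimes> Id C X))"
    by (simp add: mult_def flip: T_Comp)
  have "mult (H \<odot> X) \<cdot> T (T (mult X)) \<cdot> rebracket X = mult (H \<odot> X)
      \<cdot> T (T (\<mu> \<otimes> Id C X)) \<cdot> Assoc C H H ((H \<odot> H) \<odot> X) \<cdot> Assoc C (H \<odot> H) (H \<odot> H) X"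
    by (simp add: rebracket_def Comp_extend_single[OF 2])
  also have "\<dots> = (\<mu> \<otimes> (\<mu> \<otimes> Id C X)) \<cdot> Assoc C (H \<odot> H) (H \<odot> H) X"
    by (simp add: Comp_extend[OF 1] mult_def fuse)
  also have "\<dots> = Assoc C H H X \<cdot> ((\<mu> \<otimes> \<mu>) \<otimes> Id C X)"
    using Assoc_nat[of \<mu> \<mu> "Id C X"] by simp
  finally show ?thesis .
qed

text \<open>Multiplicativity of \<Delta>, that is (xy)_1 \<otimes> (xy)_2 = x_1 y_1 \<otimes> x_2
  y_2, is tensored with \<open>X\<close>. The factors \<open>\<mu> \<otimes> \<mu>\<close>, the
  interchange and \<open>\<Delta> \<otimes> \<Delta>\<close> are then translated one at a time by
  the three \<open>rebracket\<close> lemmas.\<close>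

lemma comult_mult:
  "comult X \<cdot> mult X = mult (H \<odot> X) \<cdot> T (T (mult X)) \<cdot> T (flip (H \<odot> X))
     \<cdot> comult (H \<odot> (H \<odot> X)) \<cdot> T (comult X)"
proof -
  have "comult X \<cdot> mult X = Assoc C H H X \<cdot> ((\<Delta> \<cdot> \<mu>) \<otimes> Id C X) \<cdot> assoc_inv H H X"
    by (simp add: comult_def mult_def fuse)
  also have "\<Delta> \<cdot> \<mu> = (\<mu> \<otimes> \<mu>) \<cdot> interchange C H H H H \<cdot> (\<Delta> \<otimes> \<Delta>)"
    using comult_hom by (simp add: is_algebra_hom_def tensor_mult_def)
  also have "Assoc C H H X \<cdot> (\<dots> \<otimes> Id C X) \<cdot> assoc_inv H H X
      = (Assoc C H H X \<cdot> ((\<mu> \<otimes> \<mu>) \<otimes> Id C X)) \<cdot> (interchange C H H H H \<otimes> Id C X)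
        \<cdot> ((\<Delta> \<otimes> \<Delta>) \<otimes> Id C X) \<cdot> assoc_inv H H X"
    by (simp add: fuse)
  also have "\<dots> = mult (H \<odot> X) \<cdot> T (T (mult X)) \<cdot> (rebracket X \<cdot> (interchange C H H H H \<otimes> Id C X))
        \<cdot> ((\<Delta> \<otimes> \<Delta>) \<otimes> Id C X) \<cdot> assoc_inv H H X"
    by (simp flip: mult_rebracket)
  also have "\<dots> = mult (H \<odot> X) \<cdot> T (T (mult X)) \<cdot> T (flip (H \<odot> X))
        \<cdot> (rebracket X \<cdot> ((\<Delta> \<otimes> \<Delta>) \<otimes> Id C X)) \<cdot> assoc_inv H H X"
    by (simp flip: flip_rebracket)
  also have "\<dots> = mult (H \<odot> X) \<cdot> T (T (mult X)) \<cdot> T (flip (H \<odot> X))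
     \<cdot> comult (H \<odot> (H \<odot> X)) \<cdot> T (comult X)"
    unfolding rebracket_comult by simp
  finally show ?thesis .
qed

end

subsection \<open>The fusion operator and the flip\<close>

lemma whiskered_nat_extend:
  assumes "f \<in> Arr C" "Dom C f = X" "Cod C f = Y" and "g \<in> Arr C"
  shows mult_nat_extend: "Cod C g = H \<odot> (H \<odot> X) \<Longrightarrow> T f \<cdot> mult X \<cdot> g = mult Y \<cdot> T (T f) \<cdot> g"
    and unit_nat_extend: "Cod C g = X \<Longrightarrow> T f \<cdot> unit X \<cdot> g = unit Y \<cdot> f \<cdot> g"
    and antipode_nat_extend: "Cod C g = H \<odot> X \<Longrightarrow> T f \<cdot> antipode X \<cdot> g = antipode Y \<cdot> T f \<cdot> g"
  using assms Obj_typing[OF assms(1)]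
  by (auto intro!: Comp_extend whiskered_nat)

text \<open>In Sweedler notation, \<open>fusion X\<close> is \<open>x \<otimes> y \<mapsto> x y\<^sub>1 \<otimes> y\<^sub>2\<close> and its inverse is
  \<open>x \<otimes> y \<mapsto> x S(y\<^sub>1) \<otimes> y\<^sub>2\<close>.\<close>

definition fusion :: "'o \<Rightarrow> 'a" where
  "fusion X = mult (H \<odot> X) \<cdot> T (comult X)"

definition fusion_inv :: "'o \<Rightarrow> 'a" where
  "fusion_inv X = mult (H \<odot> X) \<cdot> T (antipode (H \<odot> X)) \<cdot> T (comult X)"

text \<open>\<open>shuffle X\<close> is \<open>x \<otimes> y \<mapsto> S(x\<^sub>1) (x\<^sub>2 y)\<^sub>1 \<otimes> (x\<^sub>2 y)\<^sub>2 = y\<^sub>1 \<otimes> x y\<^sub>2\<close>.\<close>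

definition shuffle :: "'o \<Rightarrow> 'a" where
  "shuffle X = mult (H \<odot> X) \<cdot> antipode (H \<odot> (H \<odot> X)) \<cdot> T (comult X \<cdot> mult X) \<cdot> comult (H \<odot> X)"

context
  fixes X
  assumes X [simp]: "X \<in> Obj C"
begin

lemma fusion_typing [simp]:
  "fusion X \<in> Arr C" "Dom C (fusion X) = H \<odot> (H \<odot> X)" "Cod C (fusion X) = H \<odot> (H \<odot> X)"
  "fusion_inv X \<in> Arr C" "Dom C (fusion_inv X) = H \<odot> (H \<odot> X)" "Cod C (fusion_inv X) = H \<odot> (H \<odot> X)"
  by (simp_all add: fusion_def fusion_inv_def)

text \<open>x S(y_1) y_2 \<otimes> y_3 = x \<otimes> y, by coassociativity, the left antipode law
  and the counit.\<close>

lemma fusion_fusion_inv: "fusion X \<cdot> fusion_inv X = Id C (H \<odot> (H \<odot> X))"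
proof -
  let ?m = "mult (H \<odot> X)" and ?d = "comult X" and ?s = "antipode (H \<odot> X)"
  let ?e = "unit (H \<odot> X)"
  have "fusion X \<cdot> fusion_inv X = ?m \<cdot> mult (H \<odot> (H \<odot> X)) \<cdot> T (T ?d) \<cdot> T ?s \<cdot> T ?d"
    by (simp add: fusion_def fusion_inv_def mult_nat_extend[of ?d])
  also have "\<dots> = ?m \<cdot> T (?m \<cdot> (T ?d \<cdot> ?s) \<cdot> ?d)"
    by (simp add: Comp_extend[OF mult_assoc])
  also have "T ?d \<cdot> ?s = antipode (H \<odot> (H \<odot> X)) \<cdot> T ?d"
    by (rule antipode_nat) simp_all
  also have "?m \<cdot> \<dots> \<cdot> ?d = (?m \<cdot> antipode (H \<odot> (H \<odot> X)) \<cdot> comult (H \<odot> X)) \<cdot> ?d"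
    by (simp add: comult_coassoc)
  also have "\<dots> = ?e"
    unfolding antipode_left_whiskered[OF OTensor_in_Obj[OF H_Obj X]]
    by (simp add: counit_comult_left)
  finally show ?thesis
    by (simp add: mult_unit_right)
qed

text \<open>x y_1 S(y_2) \<otimes> y_3 = x \<otimes> y, now by the right antipode law.\<close>

lemma fusion_inv_fusion: "fusion_inv X \<cdot> fusion X = Id C (H \<odot> (H \<odot> X))"
proof -
  let ?m = "mult (H \<odot> X)" and ?d = "comult X" and ?s = "antipode (H \<odot> X)"
  let ?e = "unit (H \<odot> X)"
  have "fusion_inv X \<cdot> fusion X = ?m \<cdot> mult (H \<odot> (H \<odot> X)) \<cdot> T (T ?s) \<cdot> T (T ?d) \<cdot> T ?d"
    by (simp add: fusion_def fusion_inv_def mult_nat_extend[of ?d] mult_nat_extend[of ?s])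
  also have "\<dots> = ?m \<cdot> T (?m \<cdot> T ?s \<cdot> (T ?d \<cdot> ?d))"
    by (simp add: Comp_extend[OF mult_assoc])
  also have "T ?d \<cdot> ?d = comult (H \<odot> X) \<cdot> ?d"
    by (rule comult_coassoc) simp
  also have "?m \<cdot> T ?s \<cdot> \<dots> = (?m \<cdot> T ?s \<cdot> comult (H \<odot> X)) \<cdot> ?d"
    by simp
  also have "\<dots> = ?e"
    unfolding antipode_right_whiskered[OF OTensor_in_Obj[OF H_Obj X]]
    by (simp add: counit_comult_left)
  finally show ?thesis
    by (simp add: mult_unit_right)
qed

text \<open>With x = 1 the inverse yields S(y_1) \<otimes> y_2; the next two lemmas extract S(y_1)
  y_2 and S(y_1) \<epsilon>(y_2) = S(y) from it.\<close>

lemma fusion_inv_unit: "fusion_inv X \<cdot> unit (H \<odot> X) = antipode (H \<odot> X) \<cdot> comult X"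
proof -
  have "fusion_inv X \<cdot> unit (H \<odot> X) = mult (H \<odot> X) \<cdot> T (antipode (H \<odot> X) \<cdot> comult X) \<cdot> unit (H \<odot> X)"
    by (simp add: fusion_inv_def)
  also have "\<dots> = (mult (H \<odot> X) \<cdot> unit (H \<odot> (H \<odot> X))) \<cdot> antipode (H \<odot> X) \<cdot> comult X"
    by (subst unit_nat[where Y = "H \<odot> (H \<odot> X)"]) simp_all
  finally show ?thesis
    by (simp add: mult_unit_left)
qed

lemma mult_fusion_inv_unit: "mult X \<cdot> fusion_inv X \<cdot> unit (H \<odot> X) = unit X \<cdot> counit X"
  by (simp add: fusion_inv_unit antipode_left_whiskered)

lemma antipode_eq: "T (counit X) \<cdot> fusion_inv X \<cdot> unit (H \<odot> X) = antipode X"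
proof -
  have "T (counit X) \<cdot> fusion_inv X \<cdot> unit (H \<odot> X) = antipode X \<cdot> T (counit X) \<cdot> comult X"
    unfolding fusion_inv_unit by (rule antipode_nat_extend) simp_all
  then show ?thesis
    by (simp add: counit_comult_right)
qed

text \<open>x_1 S(x_2) \<epsilon>(x_3) is \<eta> \<epsilon>, built on the left-hand side without
  \<eta>; this serves the case where only \<epsilon> is given.\<close>

lemma counit_fusion_inv_comult: "T (counit X) \<cdot> fusion_inv X \<cdot> comult X = unit X \<cdot> counit X"
proof -
  let ?s = "antipode X"
  have "T (counit X) \<cdot> fusion_inv X \<cdot> comult X
      = mult X \<cdot> T (T (counit X) \<cdot> antipode (H \<odot> X) \<cdot> comult X) \<cdot> comult X"
    by (simp add: fusion_inv_def mult_nat_extend)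
  also have "T (counit X) \<cdot> antipode (H \<odot> X) \<cdot> comult X = ?s \<cdot> T (counit X) \<cdot> comult X"
    by (rule antipode_nat_extend) simp_all
  also have "\<dots> = ?s"
    by (simp add: counit_comult_right)
  finally show ?thesis
    by (simp add: antipode_right_whiskered)
qed

lemma shuffle_typing [simp]:
  "shuffle X \<in> Arr C" "Dom C (shuffle X) = H \<odot> (H \<odot> X)" "Cod C (shuffle X) = H \<odot> (H \<odot> X)"
  by (simp_all add: shuffle_def)

text \<open>S(x_1) (x_2 y)_1 \<otimes> (x_2 y)_2 = S(x_1) x_2 y_1 \<otimes> x_3 y_2 by the bialgebra
  law, and S(x_1) x_2 cancels. Most steps are naturality, bringing the two parts of \<open>x\<close>
  next to each other.\<close>

lemma shuffle_eq: "shuffle X = T (mult X) \<cdot> flip (H \<odot> X) \<cdot> T (comult X)"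
proof -
  let ?X1 = "H \<odot> X" let ?X2 = "H \<odot> ?X1" let ?X3 = "H \<odot> ?X2" let ?X4 = "H \<odot> ?X3"
  let ?g = "mult ?X1 \<cdot> T (T (mult X)) \<cdot> T (flip ?X1)"
  have "shuffle X = mult ?X1 \<cdot> antipode ?X2 \<cdot> T (?g \<cdot> comult ?X2 \<cdot> T (comult X)) \<cdot> comult ?X1"
    by (simp add: shuffle_def comult_mult del: T_Comp)
  also have "\<dots> = mult ?X1 \<cdot> antipode ?X2 \<cdot> T ?g \<cdot> T (comult ?X2) \<cdot> T (T (comult X)) \<cdot> comult ?X1"
    by simp
  \<comment> \<open>The coproduct of \<open>y\<close> moves to the right, so that the two coproducts
    applied to \<open>x\<close> meet and coassociativity applies.\<close>
  also have "T (T (comult X)) \<cdot> comult ?X1 = comult ?X2 \<cdot> T (comult X)"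
    by (rule comult_nat) simp_all
  also have "T (comult ?X2) \<cdot> \<dots> = comult ?X3 \<cdot> comult ?X2 \<cdot> T (comult X)"
    by (simp add: Comp_extend[OF comult_coassoc])
  \<comment> \<open>The antipode affects x_1 alone and commutes with everything done to the other
    factors.\<close>
  also have "antipode ?X2 \<cdot> T ?g \<cdot> \<dots> = T ?g \<cdot> antipode ?X4 \<cdot> \<dots>"
    by (rule antipode_nat_extend[symmetric]) simp_all
  also have "mult ?X1 \<cdot> \<dots> = (mult ?X1 \<cdot> T (mult ?X1)) \<cdot> T (T (T (mult X) \<cdot> flip ?X1))
      \<cdot> antipode ?X4 \<cdot> comult ?X3 \<cdot> comult ?X2 \<cdot> T (comult X)"
    by simp
  also have "mult ?X1 \<cdot> T (mult ?X1) = mult ?X1 \<cdot> mult ?X2"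
    by (simp add: mult_assoc)
  also have "(mult ?X1 \<cdot> mult ?X2) \<cdot> T (T (T (mult X) \<cdot> flip ?X1))
      \<cdot> antipode ?X4 \<cdot> comult ?X3 \<cdot> comult ?X2 \<cdot> T (comult X)
    = mult ?X1 \<cdot> (mult ?X2 \<cdot> T (T (T (mult X) \<cdot> flip ?X1))
      \<cdot> antipode ?X4 \<cdot> comult ?X3 \<cdot> comult ?X2 \<cdot> T (comult X))"
    by simp
  \<comment> \<open>The product of S(x_1) with x_2 is moved ahead of the flip and the other product,
    next to the antipode.\<close>
  also have "mult ?X2 \<cdot> T (T (T (mult X) \<cdot> flip ?X1))
      \<cdot> antipode ?X4 \<cdot> comult ?X3 \<cdot> comult ?X2 \<cdot> T (comult X)
    = T (T (mult X) \<cdot> flip ?X1) \<cdot> mult ?X3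
      \<cdot> antipode ?X4 \<cdot> comult ?X3 \<cdot> comult ?X2 \<cdot> T (comult X)"
    by (rule mult_nat_extend[symmetric]) simp_all
  also have "\<dots> = T (T (mult X) \<cdot> flip ?X1)
      \<cdot> (mult ?X3 \<cdot> antipode ?X4 \<cdot> comult ?X3) \<cdot> comult ?X2 \<cdot> T (comult X)"
    by simp
  also have "mult ?X3 \<cdot> antipode ?X4 \<cdot> comult ?X3 = unit ?X3 \<cdot> counit ?X3"
    by (rule antipode_left_whiskered) simp
  also have "T (T (mult X) \<cdot> flip ?X1) \<cdot> (unit ?X3 \<cdot> counit ?X3) \<cdot> comult ?X2 \<cdot> T (comult X)
      = T (T (mult X) \<cdot> flip ?X1) \<cdot> unit ?X3 \<cdot> T (comult X)"
    by (simp add: Comp_extend_single[OF counit_comult_left])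
  also have "\<dots> = unit ?X2 \<cdot> (T (mult X) \<cdot> flip ?X1) \<cdot> T (comult X)"
    by (rule unit_nat_extend) simp_all
  also have "mult ?X1 \<cdot> \<dots> = T (mult X) \<cdot> flip ?X1 \<cdot> T (comult X)"
    by (simp add: Comp_extend_single[OF mult_unit_left])
  finally show ?thesis .
qed

end

text \<open>On x \<otimes> y the composite gives y_1 \<otimes> (x y_2) S(y_3), which collapses to y
  \<otimes> x by associativity, the right antipode law and the counit.\<close>

lemma flip_eq:
  assumes [simp]: "X \<in> Obj C"
  shows "T (mult X) \<cdot> T (T (antipode X)) \<cdot> shuffle (H \<odot> X) \<cdot> T (comult X) = flip X"
proof -
  let ?X1 = "H \<odot> X" let ?X2 = "H \<odot> ?X1"
  let ?s = "antipode X"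
  \<comment> \<open>Associativity regroups the product so that y_2 stands beside S(y_3).\<close>
  have "mult X \<cdot> T ?s \<cdot> mult ?X1 = mult X \<cdot> T (mult X \<cdot> T ?s)"
    by (simp add: mult_nat Comp_extend[OF mult_assoc])
  from arg_cong[OF this, of T]
  have 1: "T (mult X) \<cdot> T (T ?s) \<cdot> T (mult ?X1) = T (mult X) \<cdot> T (T (mult X \<cdot> T ?s))"
    by simp
  have "T (mult X) \<cdot> T (T ?s) \<cdot> shuffle ?X1 \<cdot> T (comult X)
      = (T (mult X) \<cdot> T (T ?s) \<cdot> T (mult ?X1)) \<cdot> flip ?X2 \<cdot> T (comult ?X1) \<cdot> T (comult X)"
    by (simp add: shuffle_eq)
  also have "\<dots> = T (mult X) \<cdot> T (T (mult X \<cdot> T ?s)) \<cdot> flip ?X2 \<cdot> T (comult ?X1 \<cdot> comult X)"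
    unfolding 1 by simp
  \<comment> \<open>With y_2 and y_3 coming from a coproduct on the inner factor, that coproduct
    commutes with the flip by naturality.\<close>
  also have "comult ?X1 \<cdot> comult X = T (comult X) \<cdot> comult X"
    by (simp add: comult_coassoc)
  also have "T (mult X) \<cdot> T (T (mult X \<cdot> T ?s)) \<cdot> flip ?X2 \<cdot> T \<dots>
      = T (mult X) \<cdot> T (T (mult X \<cdot> T ?s)) \<cdot> (flip ?X2 \<cdot> T (T (comult X))) \<cdot> T (comult X)"
    by simp
  also have "flip ?X2 \<cdot> T (T (comult X)) = T (T (comult X)) \<cdot> flip ?X1"
    by (rule flip_nat[symmetric]) simp_all
  also have "T (mult X) \<cdot> T (T (mult X \<cdot> T ?s)) \<cdot> \<dots> \<cdot> T (comult X)
      = T (mult X) \<cdot> T (T (mult X \<cdot> T ?s \<cdot> comult X)) \<cdot> flip ?X1 \<cdot> T (comult X)"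
    by simp
  also have "mult X \<cdot> T ?s \<cdot> comult X = unit X \<cdot> counit X"
    by (simp add: antipode_right_whiskered)
  also have "T (mult X) \<cdot> T (T (unit X \<cdot> counit X)) \<cdot> flip ?X1 \<cdot> T (comult X)
      = T (mult X \<cdot> T (unit X)) \<cdot> (T (T (counit X)) \<cdot> flip ?X1) \<cdot> T (comult X)"
    by simp
  also have "T (T (counit X)) \<cdot> flip ?X1 = flip X \<cdot> T (T (counit X))"
    by (rule flip_nat) simp_all
  also have "mult X \<cdot> T (unit X) = Id C ?X1"
    by (simp add: mult_unit_right)
  also have "T (Id C ?X1) \<cdot> (flip X \<cdot> T (T (counit X))) \<cdot> T (comult X)
      = flip X \<cdot> T (T (counit X) \<cdot> comult X)"
    by simp
  also have "\<dots> = flip X"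
    by (simp add: counit_comult_right)
  finally show ?thesis .
qed

end

section \<open>Weakly retraction closed subcategories\<close>

text \<open>Only \<mu> and \<Delta>, common to both generating sets, are put into \<open>Y\<close>;
  \<eta> or \<epsilon> enters as a hypothesis of the lemmas.\<close>

locale hopf_subcategory = hopf_algebra +
  fixes Y
  assumes subcategory: "monoidal_subcategory_on C H Y"
    and retraction_closed: "weakly_retraction_closed C Y"
    and mult_in: "\<mu> \<in> Y" and comult_in: "\<Delta> \<in> Y"
begin

section \<open>Closure properties of the class \<open>Y\<close>\<close>

lemma Y_Comp: "\<lbrakk>g \<in> Y; f \<in> Y; Dom C g = Cod C f\<rbrakk> \<Longrightarrow> g \<cdot> f \<in> Y"
  using subcategory by (auto simp: monoidal_subcategory_on_def)

lemma Y_Tensor: "\<lbrakk>f \<in> Y; g \<in> Y\<rbrakk> \<Longrightarrow> f \<otimes> g \<in> Y"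
  using subcategory by (auto simp: monoidal_subcategory_on_def)

lemma Y_constraints:
  assumes "A \<in> tensor_powers C H"
  shows "Id C A \<in> Y" and "LUnit C A \<in> Y" and "RUnit C A \<in> Y"
    and "\<lbrakk>B \<in> tensor_powers C H; D \<in> tensor_powers C H\<rbrakk> \<Longrightarrow> Assoc C A B D \<in> Y"
  using subcategory assms by (auto simp: monoidal_subcategory_on_def)

lemma retraction_iff:
  assumes "p \<cdot> s = Id C (Dom C s)" and "s \<cdot> p \<in> Y"
    and "s \<in> Arr C" "p \<in> Arr C" "Dom C p = Cod C s" "Cod C p = Dom C s"
  shows "s \<in> Y \<longleftrightarrow> p \<in> Y"
  using retraction_closed assms unfolding weakly_retraction_closed_def
  by (metis HomI Obj_typing)

text \<open>An inverse pair is a retraction whose idempotent \<open>g \<cdot> f\<close> is an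
  identity, and this identity lies in \<open>Y\<close> because \<open>Dom C f\<close> is a tensor
  power.\<close>

lemma inverse_in:
  assumes "inverse_arrows C f g" and "f \<in> Y" and "Dom C f \<in> tensor_powers C H"
  shows "g \<in> Y"
proof -
  have "g \<in> Y \<longleftrightarrow> f \<in> Y"
    by (rule retraction_iff)
      (use assms Y_constraints in \<open>auto simp: inverse_arrows_def Hom_def\<close>)
  then show ?thesis
    using assms by simp
qed

lemma Inv_in: "\<lbrakk>is_iso C f; f \<in> Y; Dom C f \<in> tensor_powers C H\<rbrakk> \<Longrightarrow> Inv C f \<in> Y"
  by (rule inverse_in[OF Inv_inverse])

lemma tensor_powers_closed [simp]:
  "Unit C \<in> tensor_powers C H" "H \<in> tensor_powers C H"
  "\<lbrakk>A \<in> tensor_powers C H; B \<in> tensor_powers C H\<rbrakk> \<Longrightarrow> A \<odot> B \<in> tensor_powers C H"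
  by (rule tensor_powers.intros; assumption)+

lemma tensor_powers_Obj [simp]: "A \<in> tensor_powers C H \<Longrightarrow> A \<in> Obj C"
  by (rule tensor_powers_in_Obj[OF H_Obj])

lemma Inv_constraints:
  assumes "A \<in> tensor_powers C H"
  shows "Inv C (LUnit C A) \<in> Y" and "Inv C (RUnit C A) \<in> Y"
    and "\<lbrakk>B \<in> tensor_powers C H; D \<in> tensor_powers C H\<rbrakk> \<Longrightarrow> assoc_inv A B D \<in> Y"
  using assms by (auto intro!: Inv_in Y_constraints)

lemmas Y_intros = Y_Comp Y_Tensor Y_constraints Inv_constraints mult_in comult_in

text \<open>The whiskered maps are used at the unit object; conjugation by the right unit constraint
  then removes that factor.\<close>

lemma Y_cancel_Unit:
  assumes "f \<otimes> Id C (Unit C) \<in> Y" and "f \<in> Arr C"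
    and "Dom C f \<in> tensor_powers C H" "Cod C f \<in> tensor_powers C H"
  shows "f \<in> Y"
proof -
  have "f = (f \<cdot> RUnit C (Dom C f)) \<cdot> Inv C (RUnit C (Dom C f))"
    using assms by simp
  also have "\<dots> = (RUnit C (Cod C f) \<cdot> (f \<otimes> Id C (Unit C))) \<cdot> Inv C (RUnit C (Dom C f))"
    using assms by (simp only: RUnit_nat)
  also have "\<dots> \<in> Y"
    by (intro Y_Comp Y_constraints Inv_constraints assms) (use assms in simp_all)
  finally show ?thesis .
qed

lemma T_in: "f \<in> Y \<Longrightarrow> T f \<in> Y"
  unfolding T_def by (intro Y_intros) simp_all

lemma whiskered_in:
  assumes "A \<in> tensor_powers C H"
  shows "mult A \<in> Y" and "comult A \<in> Y"
    and "\<eta> \<in> Y \<Longrightarrow> unit A \<in> Y" and "\<epsilon> \<in> Y \<Longrightarrow> counit A \<in> Y"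
    and "S \<in> Y \<Longrightarrow> antipode A \<in> Y"
  unfolding whiskered_defs using assms by (auto intro!: Y_intros)

section \<open>Membership of the structure maps and of the flip\<close>

lemma fusion_inv_in: "fusion_inv (Unit C) \<in> Y"
proof (rule inverse_in)
  show "inverse_arrows C (fusion (Unit C)) (fusion_inv (Unit C))"
    by (simp add: inverse_arrows_def fusion_fusion_inv fusion_inv_fusion Hom_def)
  show "fusion (Unit C) \<in> Y"
    unfolding fusion_def by (intro Y_intros T_in whiskered_in) simp_all
qed simp

text \<open>\<open>counit_unit\<close> supplies the retraction and the hypothesis its idempotent.
  The rest strips the unit constraints from the whiskered maps.\<close>

lemma unit_counit_iff:
  assumes "unit (Unit C) \<cdot> counit (Unit C) \<in> Y"
  shows "\<eta> \<in> Y \<longleftrightarrow> \<epsilon> \<in> Y"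
proof -
  have "unit (Unit C) \<in> Y \<longleftrightarrow> counit (Unit C) \<in> Y"
    by (rule retraction_iff) (use assms in \<open>simp_all add: counit_unit\<close>)
  moreover have "unit (Unit C) \<in> Y \<longleftrightarrow> \<eta> \<in> Y"
  proof
    assume "unit (Unit C) \<in> Y"
    then have "unit (Unit C) \<cdot> LUnit C (Unit C) \<in> Y"
      by (intro Y_intros) simp_all
    then have "\<eta> \<otimes> Id C (Unit C) \<in> Y"
      by (simp add: unit_def)
    then show "\<eta> \<in> Y"
      by (rule Y_cancel_Unit) simp_all
  qed (simp add: whiskered_in)
  moreover have "counit (Unit C) \<in> Y \<longleftrightarrow> \<epsilon> \<in> Y"
  proof
    assume "counit (Unit C) \<in> Y"
    then have "Inv C (LUnit C (Unit C)) \<cdot> counit (Unit C) \<in> Y"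
      by (intro Y_intros) simp_all
    then have "\<epsilon> \<otimes> Id C (Unit C) \<in> Y"
      by (simp add: counit_def)
    then show "\<epsilon> \<in> Y"
      by (rule Y_cancel_Unit) simp_all
  qed (simp add: whiskered_in)
  ultimately show ?thesis
    by simp
qed

text \<open>The idempotent \<eta> \<epsilon> is obtained as S(y_1) y_2 from the inverse fusion map
  applied to 1 \<otimes> y.\<close>

lemma unit_imp_counit:
  assumes "\<eta> \<in> Y"
  shows "\<epsilon> \<in> Y"
proof -
  have "mult (Unit C) \<cdot> fusion_inv (Unit C) \<cdot> unit (H \<odot> Unit C) \<in> Y"
    using assms by (intro Y_intros fusion_inv_in whiskered_in) simp_all
  then show ?thesis
    using assms unit_counit_iff by (simp add: mult_fusion_inv_unit)
qed

lemma counit_imp_unit: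
  assumes "\<epsilon> \<in> Y"
  shows "\<eta> \<in> Y"
proof -
  have "T (counit (Unit C)) \<cdot> fusion_inv (Unit C) \<cdot> comult (Unit C) \<in> Y"
    using assms by (intro Y_intros fusion_inv_in whiskered_in T_in) simp_all
  then show ?thesis
    using assms unit_counit_iff by (simp add: counit_fusion_inv_comult)
qed

lemma antipode_in:
  assumes "\<eta> \<in> Y"
  shows "S \<in> Y"
proof -
  have "T (counit (Unit C)) \<cdot> fusion_inv (Unit C) \<cdot> unit (H \<odot> Unit C) \<in> Y"
    using assms unit_imp_counit by (intro Y_intros fusion_inv_in whiskered_in T_in) simp_all
  then have "S \<otimes> Id C (Unit C) \<in> Y"
    by (simp add: antipode_eq) (simp add: antipode_def)
  then show ?thesis
    by (rule Y_cancel_Unit) simp_all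
qed

lemma Sym_in:
  assumes "\<eta> \<in> Y"
  shows "Sym C H H \<in> Y"
proof -
  let ?I = "Unit C"
  \<comment> \<open>By definition \<open>shuffle\<close> is composed of products, coproducts and
    antipodes; the symmetry does not occur in it.\<close>
  have "shuffle (H \<odot> ?I) \<in> Y"
    unfolding shuffle_def
    using antipode_in[OF assms] by (intro Y_intros T_in whiskered_in) simp_all
  then have "T (mult ?I) \<cdot> T (T (antipode ?I)) \<cdot> shuffle (H \<odot> ?I) \<cdot> T (comult ?I) \<in> Y"
    using antipode_in[OF assms] by (intro Y_intros T_in whiskered_in) simp_all
  then have "flip ?I \<in> Y"
    by (simp add: flip_eq)
  then have "assoc_inv H H ?I \<cdot> flip ?I \<cdot> Assoc C H H ?I \<in> Y"
    by (intro Y_intros) simp_all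
  then have "Sym C H H \<otimes> Id C ?I \<in> Y"
    by (simp add: flip_def)
  then show ?thesis
    by (rule Y_cancel_Unit) simp_all
qed

end

theorem theorem0p1:
  fixes C :: "('o, 'a, 'm) smc_data_scheme"
    and H :: 'o and \<mu> \<eta> \<Delta> \<epsilon> S :: 'a
    and X :: "'a set"
  assumes "hopf_algebra C H \<mu> \<eta> \<Delta> \<epsilon> S"
    and "X = {\<mu>, \<Delta>, \<eta>} \<or> X = {\<mu>, \<Delta>, \<epsilon>}"
  shows "Sym C H H \<in> generated_subcategory C H X \<and>
         S \<in> generated_subcategory C H X \<and>
         \<epsilon> \<in> generated_subcategory C H X \<and>
         \<eta> \<in> generated_subcategory C H X"
proof -
  interpret hopf_algebra C H \<mu> \<eta> \<Delta> \<epsilon> S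
    by (rule assms(1))
  have "X \<subseteq> Arr C"
    using assms(2) by auto
  note gen = generated_subcategory_least[OF H_Obj this]
  \<comment> \<open>The generated class is itself closed, so it serves as \<open>Y\<close> and no
    induction on its generation is needed.\<close>
  interpret hopf_subcategory C H \<mu> \<eta> \<Delta> \<epsilon> S "generated_subcategory C H X"
    using gen(1-3) assms(2) by unfold_locales auto
  \<comment> \<open>For the generators with \<epsilon>, the unit is recovered from the counit; from
    here on both cases coincide.\<close>
  have "\<eta> \<in> generated_subcategory C H X"
    using gen(1) assms(2) counit_imp_unit by auto
  then show ?thesis
    using Sym_in antipode_in unit_imp_counit by simp
qed

end
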